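(* Let $0<\theta<1$ be such that $\rho=\rho(\theta):=6\frac{\alpha^*}{\alpha_*}\sqrt{1-\theta^2}<1$. Assume $\mathbf A\in\mathcal D_e(\eta_L)$ with a constant $c_L$ satisfying $c_L<\frac12(e^{\eta_L}-1)\min_\ell a_{\ell,\ell}$. Then the sequence $u_n$ ($n\ge0$) generated by Algorithm PC-ADLEG$(\theta,tol)$ satisfies $$|\!|\!|u-u_{n+1}|\!|\!|\le\rho\,|\!|\!|u-u_n|\!|\!|\quad\text{for all }n.$$ Consequently, for any $tol>0$ the algorithm terminates after finitely many iterations, and for $tol=0$ the sequence $u_n$ converges to $u$ in $H^1(I)$.
   Context: Setting. $I=(-1,1)$, $V=H^1_0(I)$, $L_k$ Legendre polynomials with $L_k(1)=1$, $\eta_k=\frac{1}{\sqrt{4k-2}}(L_{k-2}-L_k)$ for $k\in\mathbb N_2:=\{k\ge2\}$, an orthonormal basis of $V$ for $\int u'v'$. $v\in V$: $v=\sum\hat v_k\eta_k$, $\|v\|=(\sum|\hat v_k|^2)^{1/2}$; $g\in H^{-1}(I)$: $\hat g_k=\langle g,\eta_k\rangle$, $\|g\|=(\sum|\hat g_k|^2)^{1/2}$. For $\Lambda\subset\mathbb N_2$, $V_\Lambda=\mathrm{span}\{\eta_k:k\in\Lambda\}$, $P_\Lambda$ keeps only the coefficients indexed in $\Lambda$ (for functions and functionals alike). Problem: $u\in V$, $a(u,v)=\langle f,v\rangle$ $\forall v\in V$, $f\in H^{-1}(I)$, $a(w,v)=\int_I\nu w'v'+\int_I\sigma wv$, with smooth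 real $\nu,\sigma$, $0<\nu_*\le\nu\le\nu^*$, $0\le\sigma\le\sigma^*$; $Lw=-(\nu w')'+\sigma w$; $\alpha_*=\nu_*$, $\alpha^*=\max(\nu^*,\sigma^* )$; $|\!|\!|v|\!|\!|=\sqrt{a(v,v)}$. Stiffness matrix $\mathbf A=(a_{\ell,k})$, $a_{\ell,k}=a(\eta_k,\eta_\ell)$. $\mathbf A\in\mathcal D_e(\eta_L)$ means $|a_{m,n}|\le c_Le^{-\eta_L|m-n|}$ for all $m,n\ge2$. Let $\bar\eta_L\in(0,\eta_L]$ be such that $e^{-\bar\eta_L}$ is the unique zero in $(0,1)$ of $z^2-\frac{e^{2\eta_L}+2c_L+1}{e^{\eta_L}(c_L+1)}z+1$; for a matrix $\mathbf B$ and integer $J\ge0$, $\mathbf B_J$ keeps the entries with $|\ell-k|\le J$ and sets the others to $0$; let $C_{\mathbf A^{-1}}$ be a constant with $\|\mathbf A^{-1}-(\mathbf A^{-1})_J\|\le C_{\mathbf A^{-1}}e^{-\bar\eta_LJ}$ for all $J\ge0$ (operator norm on $\ell^2(\mathbb N_2)$). Procedures. GAL$(\Lambda)$ returns the Galerkin solution $u_\Lambda\in V_\Lambda$ ($a(u_\Lambda,v)=\langle f,v\rangle$ $\forall v\in V_\Lambda$). RES$(w)$ returns $r(w)=f-Lw$. DÖRFLER$(r,\theta)$ returns a finite set $\Lambda^*\subset\mathbb N_2$ of minimal cardinality with $\|P_{\Lambda^*}r\|\ge\theta\|r\|$. ENRICH$(\Lambda,J)=\{k\in\mathbb N_2:\exists\ell\in\Lambda,\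 |k-\ell|\le J\}$. $J_\theta:=\min\{J\in\mathbb N: C_{\mathbf A^{-1}}e^{-\bar\eta_LJ}\le\sqrt{(1-\theta^2)/(\alpha_*\alpha^* )}\}$. E-DÖRFLER$(r,\theta)$ := ENRICH(DÖRFLER$(r,\theta),J_\theta)$. COARSE$(w,\epsilon)$, for $w\in V_{\Lambda^*}$ with $\|u-w\|\le\epsilon$, returns $\Lambda\subseteq\Lambda^*$ of minimal cardinality with $\|w-P_\Lambda w\|\le2\epsilon$. Algorithm PC-ADLEG$(\theta,tol)$: set $r_0=f$, $\Lambda_0=\emptyset$, $u_0=0$, $n=-1$; repeat: $n\leftarrow n+1$; $\widehat{\partial\Lambda}_n=$ E-DÖRFLER$(r_n,\theta)$; $\widehat\Lambda_{n+1}=\Lambda_n\cup\widehat{\partial\Lambda}_n$; $\widehat u_{n+1}=$ GAL$(\widehat\Lambda_{n+1})$; $\Lambda_{n+1}=$ COARSE$(\widehat u_{n+1},\frac{2}{\alpha_*}\sqrt{1-\theta^2}\|r_n\|)$; $u_{n+1}=$ GAL$(\Lambda_{n+1})$; $r_{n+1}=$ RES$(u_{n+1})$; until $\|r_{n+1}\|\le tol$. *)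

theory Defs
  imports "HOL-Analysis.Analysis"
begin

text \<open>Legendre polynomials via the three-term recurrence (normalised L_k(1) = 1).\<close>
fun legendre :: "nat \<Rightarrow> real \<Rightarrow> real" where
  "legendre 0 x = 1"
| "legendre (Suc 0) x = x"
| "legendre (Suc (Suc n)) x =
     ((2 * real n + 3) * x * legendre (Suc n) x - (real n + 1) * legendre n x) / (real n + 2)"

text \<open>Babuska-Shen basis eta_k (meaningful for k >= 2).\<close>
definition eta :: "nat \<Rightarrow> real \<Rightarrow> real" where
  "eta k x = (legendre (k - 2) x - legendre k x) / sqrt (4 * real k - 2)"

definition stiff :: "(real \<Rightarrow> real) \<Rightarrow> (real \<Rightarrow> real) \<Rightarrow> nat \<Rightarrow> nat \<Rightarrow> real" where
  "stiff nu sg l k = integral {-1..1}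
     (\<lambda>x. nu x * deriv (eta k) x * deriv (eta l) x + sg x * eta k x * eta l x)"

definition smooth_on :: "real set \<Rightarrow> (real \<Rightarrow> real) \<Rightarrow> bool" where
  "smooth_on S g \<longleftrightarrow> (\<forall>n. \<forall>x\<in>S. ((deriv ^^ n) g) differentiable (at x))"

text \<open>Coefficient sequences indexed by N_2 (entries 0 and 1 are zero), square summable:
  these represent elements of V = H^1_0 and of H^{-1} (via eta-coefficients).\<close>
definition seqV :: "(nat \<Rightarrow> real) \<Rightarrow> bool" where
  "seqV v \<longleftrightarrow> v 0 = 0 \<and> v 1 = 0 \<and> summable (\<lambda>k. (v k)\<^sup>2)"

definition nrm :: "(nat \<Rightarrow> real) \<Rightarrow> real" where
  "nrm v = sqrt (\<Sum>k. (v k)\<^sup>2)"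

definition proj :: "nat set \<Rightarrow> (nat \<Rightarrow> real) \<Rightarrow> nat \<Rightarrow> real" where
  "proj L v = (\<lambda>k. if k \<in> L then v k else 0)"

definition unitv :: "nat \<Rightarrow> nat \<Rightarrow> real" where
  "unitv j = (\<lambda>k. if k = j then 1 else 0)"

definition mat_app :: "(nat \<Rightarrow> nat \<Rightarrow> real) \<Rightarrow> (nat \<Rightarrow> real) \<Rightarrow> nat \<Rightarrow> real" where
  "mat_app B w = (\<lambda>l. if l < 2 then 0 else (\<Sum>k. B l (k + 2) * w (k + 2)))"

definition abil :: "(nat \<Rightarrow> nat \<Rightarrow> real) \<Rightarrow> (nat \<Rightarrow> real) \<Rightarrow> (nat \<Rightarrow> real) \<Rightarrow> real" where
  "abil A w v = (\<Sum>l. v l * mat_app A w l)"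

definition dual :: "(nat \<Rightarrow> real) \<Rightarrow> (nat \<Rightarrow> real) \<Rightarrow> real" where
  "dual g v = (\<Sum>k. g k * v k)"

definition enorm :: "(nat \<Rightarrow> nat \<Rightarrow> real) \<Rightarrow> (nat \<Rightarrow> real) \<Rightarrow> real" where
  "enorm A v = sqrt (abil A v v)"

text \<open>Residual r(w) = f - Lw, coefficients <f - Lw, eta_k> = f_k - a(w, eta_k).\<close>
definition res :: "(nat \<Rightarrow> nat \<Rightarrow> real) \<Rightarrow> (nat \<Rightarrow> real) \<Rightarrow> (nat \<Rightarrow> real) \<Rightarrow> nat \<Rightarrow> real" where
  "res A f w = (\<lambda>k. if k < 2 then 0 else f k - abil A w (unitv k))"

definition galerkin :: "(nat \<Rightarrow> nat \<Rightarrow> real) \<Rightarrow> (nat \<Rightarrow> real) \<Rightarrow> nat set \<Rightarrow> (nat \<Rightarrow> real) \<Rightarrow> bool" where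
  "galerkin A f L w \<longleftrightarrow> seqV w \<and> (\<forall>k. k \<notin> L \<longrightarrow> w k = 0) \<and>
     (\<forall>v. seqV v \<and> (\<forall>k. k \<notin> L \<longrightarrow> v k = 0) \<longrightarrow> abil A w v = dual f v)"

text \<open>L is a possible output of DOERFLER(r, theta).\<close>
definition dorfler :: "real \<Rightarrow> (nat \<Rightarrow> real) \<Rightarrow> nat set \<Rightarrow> bool" where
  "dorfler theta r L \<longleftrightarrow> finite L \<and> L \<subseteq> {2..} \<and> nrm (proj L r) \<ge> theta * nrm r \<and>
     (\<forall>L'. finite L' \<and> L' \<subseteq> {2..} \<and> nrm (proj L' r) \<ge> theta * nrm r \<longrightarrow> card L \<le> card L')"

definition enrich :: "nat set \<Rightarrow> nat \<Rightarrow> nat set" where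
  "enrich L J = {k. 2 \<le> k \<and> (\<exists>l\<in>L. k \<le> l + J \<and> l \<le> k + J)}"

text \<open>L is a possible output of COARSE(w, eps) for w in V_{Ls}.\<close>
definition coarse :: "(nat \<Rightarrow> real) \<Rightarrow> real \<Rightarrow> nat set \<Rightarrow> nat set \<Rightarrow> bool" where
  "coarse w eps Ls L \<longleftrightarrow> L \<subseteq> Ls \<and> nrm (\<lambda>k. w k - proj L w k) \<le> 2 * eps \<and>
     (\<forall>L'. L' \<subseteq> Ls \<and> nrm (\<lambda>k. w k - proj L' w k) \<le> 2 * eps \<longrightarrow> card L \<le> card L')"

definition band :: "(nat \<Rightarrow> nat \<Rightarrow> real) \<Rightarrow> nat \<Rightarrow> nat \<Rightarrow> nat \<Rightarrow> real" where
  "band B J = (\<lambda>l k. if l \<le> k + J \<and> k \<le> l + J then B l k else 0)"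

definition inv_mat :: "(nat \<Rightarrow> nat \<Rightarrow> real) \<Rightarrow> nat \<Rightarrow> nat \<Rightarrow> real" where
  "inv_mat A = (\<lambda>l k. (THE x. seqV x \<and> (\<forall>m\<ge>2. mat_app A x m = unitv k m)) l)"

definition opnorm_le :: "(nat \<Rightarrow> nat \<Rightarrow> real) \<Rightarrow> real \<Rightarrow> bool" where
  "opnorm_le B c \<longleftrightarrow> (\<forall>v. seqV v \<longrightarrow> seqV (mat_app B v) \<and> nrm (mat_app B v) \<le> c * nrm v)"

end

(* Proof idea. In the coefficients with respect to the basis eta the problem is a coercive
   symmetric system in l2. For a step with correction c = uh - un and discarded part
   d = uh - P uh, Galerkin orthogonality gives E(u - un)^2 = E(c)^2 + E(u - uh)^2 and
   E(u - u_{n+1})^2 <= E(u - uh)^2 + E(d)^2 for the energy norm E; the quasi-sparsity of the inverse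
   matrix bounds E(u - uh), and the coarsening tolerance bounds d, both by multiples of the
   residual.

   The constant alpha^* of the paper bounds the form with respect to the full H^1 norm,
   but not with respect to the norm of int u' v' used for the coefficients; there the
   best constant may exceed it by a factor up to about 1.41. The contraction factor is nevertheless
   correct: the excess is caused by the L2 mass of eta_2 alone, the two orthogonal error parts add
   up in squares, and the remaining critical case is settled by a lower bound for E(c). *)
theory Submission
  imports Defs
begin

section \<open>Legendre polynomials and the stiffness form\<close>

text \<open>The number 1.41 is 1 + 4/\<pi>^2, about 1.405, rounded up: 4/\<pi>^2 is the best
  constant bounding the squared L2 norm by that of the derivative on (-1,1). With \<open>M\<close>
  the larger of the two upper coefficient bounds, using 1.41 \<open>M\<close> both for the residual
  and for the discarded part would yield up to 1.41 (0.1331 + 1.41 4/9), about 1.07, times the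
  desired squared factor; 0.1331 stems from the enrichment, 4/9 from the coarsening. The gap can be
  closed because the constant drops to 9/8 \<open>M\<close> for sequences vanishing at index 2.
  Hence the energy bounds come in two versions, a uniform one and one with the component at index 2
  split off. The rational constants are roundings of optimal weights. Functions serve only to bound
  finite sections of the stiffness matrix. Boundedness on l2, convergence of the series in the form
  and existence of the inverse matrix are all derived from these finite bounds.\<close>

fun legendre_deriv :: "nat \<Rightarrow> real \<Rightarrow> real" where
  "legendre_deriv 0 x = 0"
| "legendre_deriv (Suc 0) x = 1"
| "legendre_deriv (Suc (Suc n)) x =
     ((2 * real n + 3) * (legendre (Suc n) x + x * legendre_deriv (Suc n) x)
       - (real n + 1) * legendre_deriv n x) / (real n + 2)"

lemma legendre_has_deriv: "(legendre n has_real_derivative legendre_deriv n x) (at x)"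
proof (induction n rule: induct_nat_012)
  case 0
  have "legendre 0 = (\<lambda>_. 1)" by (rule ext) simp
  then show ?case by simp
next
  case 1
  have "legendre (Suc 0) = (\<lambda>x. x)" by (rule ext) simp
  then show ?case by simp
next
  case (ge2 n)
  have "legendre (Suc (Suc n)) = (\<lambda>x. ((2 * real n + 3) * x * legendre (Suc n) x
      - (real n + 1) * legendre n x) / (real n + 2))"
    by (rule ext) simp
  moreover have "((\<lambda>x. ((2 * real n + 3) * x * legendre (Suc n) x - (real n + 1) * legendre n x) / (real n + 2))
      has_real_derivative legendre_deriv (Suc (Suc n)) x) (at x)"
    unfolding legendre_deriv.simps
    by (rule DERIV_cdivide) (auto intro!: derivative_eq_intros ge2 simp: algebra_simps simp del: legendre.simps)
  ultimately show ?case by simp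
qed

text \<open>Division-free, so that \<open>algebra\<close> can use it as a polynomial
  relation.\<close>

lemma legendre_recurrence:
  "(real n + 2) * legendre (Suc (Suc n)) x
    = (2 * real n + 3) * x * legendre (Suc n) x - (real n + 1) * legendre n x"
  by (simp del: of_nat_Suc)

lemma legendre_deriv_recurrence:
  "(real n + 2) * legendre_deriv (Suc (Suc n)) x
    = (2 * real n + 3) * (legendre (Suc n) x + x * legendre_deriv (Suc n) x)
       - (real n + 1) * legendre_deriv n x"
  by (simp del: of_nat_Suc)

text \<open>The identities feed each other: at \<open>n + 1\<close> the second comes from the first
  at \<open>n\<close> and the first from the second at \<open>n\<close>, each time through the
  two-step difference \<open>step\<close>.\<close>

lemma legendre_deriv_identities:
  "x * legendre_deriv (Suc n) x - legendre_deriv n x = (real n + 1) * legendre (Suc n) x"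
  "legendre_deriv (Suc n) x - x * legendre_deriv n x = (real n + 1) * legendre n x"
proof (induction n)
  case (Suc n)
  let ?L = "\<lambda>k. legendre k x" and ?D = "\<lambda>k. legendre_deriv k x"
  have "(real n + 2) * ?D (Suc (Suc n)) = (real n + 2) * (?D n + (2 * real n + 3) * ?L (Suc n))"
    using legendre_deriv_recurrence[of n x] Suc(1) by algebra
  then have step: "?D (Suc (Suc n)) = ?D n + (2 * real n + 3) * ?L (Suc n)"
    by simp
  show "?D (Suc (Suc n)) - x * ?D (Suc n) = (real (Suc n) + 1) * ?L (Suc n)"
    using step Suc(1) by (simp add: algebra_simps del: legendre.simps legendre_deriv.simps)
  have "x * ?D (Suc (Suc n)) - ?D (Suc n) = (real n + 2) * ?L (Suc (Suc n))"
    using step Suc(2) legendre_recurrence[of n x] by algebra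
  then show "x * ?D (Suc (Suc n)) - ?D (Suc n) = (real (Suc n) + 1) * ?L (Suc (Suc n))"
    by (simp del: legendre.simps legendre_deriv.simps add: add.commute)
qed simp_all

text \<open>The reason for the shape of the basis: differences of Legendre polynomials two degrees
  apart have mutually orthogonal derivatives.\<close>

lemma legendre_deriv_diff:
  "legendre_deriv (Suc (Suc n)) x - legendre_deriv n x = (2 * real n + 3) * legendre (Suc n) x"
proof -
  have "legendre_deriv (Suc (Suc n)) x - x * legendre_deriv (Suc n) x
      = (real n + 2) * legendre (Suc n) x"
    using legendre_deriv_identities(2)[of "Suc n" x] by (simp add: add.commute)
  with legendre_deriv_identities(1)[of x n] show ?thesis by algebra
qed

lemma legendre_continuous: "continuous_on S (legendre n)"
  using legendre_has_deriv by (meson DERIV_isCont continuous_at_imp_continuous_on)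

lemma legendre_deriv_weighted:
  "(1 - x\<^sup>2) * legendre_deriv (Suc n) x = (real n + 1) * (legendre n x - x * legendre (Suc n) x)"
  using legendre_deriv_identities(1)[of x n] legendre_deriv_identities(2)[of n x] by algebra

text \<open>\<open>legendre_deriv_weighted\<close> removes the derivative from the weighted product,
  so the self-adjoint Legendre equation is obtained without second derivatives.\<close>

lemma legendre_ode:
  "((\<lambda>x. (1 - x\<^sup>2) * legendre_deriv n x) has_real_derivative
     - (real n * (real n + 1)) * legendre n x) (at x)"
proof (cases n)
  case 0
  have "(\<lambda>x. (1 - x\<^sup>2) * legendre_deriv 0 x) = (\<lambda>_. 0)" by simp
  then show ?thesis using 0 by simp
next
  case (Suc m)
  have "((\<lambda>x. (real m + 1) * (legendre m x - x * legendre (Suc m) x)) has_real_derivative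
      (real m + 1) * (legendre_deriv m x - (legendre (Suc m) x + x * legendre_deriv (Suc m) x))) (at x)"
    by (auto intro!: derivative_eq_intros legendre_has_deriv)
  moreover have "(real m + 1) * (legendre_deriv m x - (legendre (Suc m) x + x * legendre_deriv (Suc m) x))
      = - ((real m + 1) * (real m + 2)) * legendre (Suc m) x"
    using legendre_deriv_identities(1)[of x m] by algebra
  ultimately show ?thesis
    unfolding Suc legendre_deriv_weighted by (simp add: add.commute)
qed

lemma legendre_prod_integrable:
  "(\<lambda>x. legendre m x * legendre n x) integrable_on {-1..1}"
  by (intro integrable_continuous_interval continuous_intros legendre_continuous)

text \<open>Both factors solve the self-adjoint Legendre equation, so the product is, up to the
  difference of the eigenvalues, the derivative of a Wronskian vanishing at the end points.\<close>
lemma legendre_orthogonal: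
  assumes "m \<noteq> n" shows "integral {-1..1} (\<lambda>x. legendre m x * legendre n x) = 0"
proof -
  define W where "W x = (1 - x\<^sup>2) * legendre_deriv n x * legendre m x
      - (1 - x\<^sup>2) * legendre_deriv m x * legendre n x" for x
  define c where "c = real m * (real m + 1) - real n * (real n + 1)"
  have "(W has_real_derivative c * (legendre m x * legendre n x)) (at x)" for x
    unfolding W_def[abs_def] c_def
    by (rule derivative_eq_intros legendre_ode legendre_has_deriv refl)+ (simp add: algebra_simps)
  then have "((\<lambda>x. c * (legendre m x * legendre n x)) has_integral (W 1 - W (-1))) {-1..1}"
    by (intro fundamental_theorem_of_calculus)
      (auto simp: has_real_derivative_iff_has_vector_derivative intro: has_vector_derivative_at_within)
  then have "c * integral {-1..1} (\<lambda>x. legendre m x * legendre n x) = 0"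
    by (simp add: W_def has_integral_iff)
  moreover have "c \<noteq> 0"
  proof -
    have "c = (real m - real n) * (real m + real n + 1)" by (simp add: c_def algebra_simps)
    then show ?thesis using assms by auto
  qed
  ultimately show ?thesis by simp
qed

text \<open>The recurrence for L_(n+2) times L_(n+2) and the one for L_(n+3) times L_(n+1) share the
  term x L_(n+1) L_(n+2). Eliminating it gives \<open>pt\<close>; after integration orthogonality
  removes the mixed products and leaves a relation between consecutive norms.\<close>

lemma legendre_norm: "integral {-1..1} (\<lambda>x. legendre n x * legendre n x) = 2 / (2 * real n + 1)"
proof (induction n rule: induct_nat_012)
  case 0 then show ?case by simp
next
  case 1
  have "((\<lambda>x::real. x * x) has_integral (1 ^ 3 / 3 - (-1) ^ 3 / 3)) {-1..1}"
    by (rule fundamental_theorem_of_calculus)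
      (auto intro!: derivative_eq_intros simp: power2_eq_square simp flip: has_real_derivative_iff_has_vector_derivative)
  then show ?case by (simp add: integral_unique)
next
  case (ge2 n)
  let ?I = "\<lambda>m n. integral {-1..1} (\<lambda>x. legendre m x * legendre n x)"
  have pt: "(real n + 2) * (2 * real n + 5) * (legendre (Suc (Suc n)) x * legendre (Suc (Suc n)) x)
     = (2 * real n + 3) * (real n + 3) * (legendre (Suc (Suc (Suc n))) x * legendre (Suc n) x)
     + (2 * real n + 3) * (real n + 2) * (legendre (Suc n) x * legendre (Suc n) x)
     - (2 * real n + 5) * (real n + 1) * (legendre (Suc (Suc n)) x * legendre n x)" for x
  proof -
    have "(real n + 3) * legendre (Suc (Suc (Suc n))) x
        = (2 * real n + 5) * x * legendre (Suc (Suc n)) x - (real n + 2) * legendre (Suc n) x"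
      using legendre_recurrence[of "Suc n" x] by (simp add: add.commute del: legendre.simps)
    with legendre_recurrence[of n x] show ?thesis by algebra
  qed
  have "(real n + 2) * (2 * real n + 5) * ?I (Suc (Suc n)) (Suc (Suc n))
     = (2 * real n + 3) * (real n + 3) * ?I (Suc (Suc (Suc n))) (Suc n)
     + (2 * real n + 3) * (real n + 2) * ?I (Suc n) (Suc n)
     - (2 * real n + 5) * (real n + 1) * ?I (Suc (Suc n)) n"
  proof -
    have "((\<lambda>x. (2 * real n + 3) * (real n + 3) * (legendre (Suc (Suc (Suc n))) x * legendre (Suc n) x)
     + (2 * real n + 3) * (real n + 2) * (legendre (Suc n) x * legendre (Suc n) x)
     - (2 * real n + 5) * (real n + 1) * (legendre (Suc (Suc n)) x * legendre n x)) has_integral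
     (2 * real n + 3) * (real n + 3) * ?I (Suc (Suc (Suc n))) (Suc n)
     + (2 * real n + 3) * (real n + 2) * ?I (Suc n) (Suc n)
     - (2 * real n + 5) * (real n + 1) * ?I (Suc (Suc n)) n) {-1..1}"
      by (intro has_integral_add has_integral_diff has_integral_mult_right integrable_integral
          legendre_prod_integrable)
    then show ?thesis
      unfolding pt[symmetric] by (simp add: integral_unique del: legendre.simps flip: integral_mult_right)
  qed
  moreover have "?I (Suc n) (Suc n) = 2 / (2 * real n + 3)"
    using ge2(2) by (simp add: add.commute)
  ultimately have "(real n + 2) * ((2 * real n + 5) * ?I (Suc (Suc n)) (Suc (Suc n))) = (real n + 2) * 2"
    using legendre_orthogonal[of "Suc (Suc (Suc n))" "Suc n"] legendre_orthogonal[of "Suc (Suc n)" n]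
    by (simp del: legendre.simps)
  then have "(2 * real n + 5) * ?I (Suc (Suc n)) (Suc (Suc n)) = 2"
    by (subst (asm) mult_cancel_left) linarith
  then show ?case by (simp add: eq_divide_eq add.commute mult.commute del: legendre.simps)
qed

lemma integral_legendre_sum_sq:
  "integral {-1..1} (\<lambda>x. (\<Sum>j<N. c j * legendre j x)\<^sup>2) = (\<Sum>j<N. (c j)\<^sup>2 * (2 / (2 * real j + 1)))"
proof -
  have "((\<lambda>x. \<Sum>i<N. \<Sum>j<N. c i * c j * (legendre i x * legendre j x)) has_integral
      (\<Sum>i<N. \<Sum>j<N. c i * c j * integral {-1..1} (\<lambda>x. legendre i x * legendre j x))) {-1..1}"
    by (intro has_integral_sum has_integral_mult_right integrable_integral legendre_prod_integrable) auto
  moreover have "(\<lambda>x. \<Sum>i<N. \<Sum>j<N. c i * c j * (legendre i x * legendre j x))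
      = (\<lambda>x. (\<Sum>j<N. c j * legendre j x)\<^sup>2)"
    by (simp add: power2_eq_square sum_product algebra_simps)
  moreover have "(\<Sum>i<N. \<Sum>j<N. c i * c j * integral {-1..1} (\<lambda>x. legendre i x * legendre j x))
      = (\<Sum>i<N. \<Sum>j<N. if j = i then (c i)\<^sup>2 * (2 / (2 * real i + 1)) else 0)"
    by (intro sum.cong refl) (auto simp: legendre_orthogonal legendre_norm power2_eq_square)
  ultimately show ?thesis by (simp add: integral_unique sum.delta)
qed

section \<open>Basis functions: derivatives, orthonormality and L2 mass\<close>

definition eta' :: "nat \<Rightarrow> real \<Rightarrow> real" where
  "eta' k x = (legendre_deriv (k - 2) x - legendre_deriv k x) / sqrt (4 * real k - 2)"

text \<open>True at \<open>k = 0\<close> as well, since \<open>sqrt\<close> is odd and nonzero at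
  -2; thus continuity of the basis functions needs no index restriction.\<close>

lemma eta_scale_neq_0: "sqrt (4 * real k - 2) \<noteq> 0"
proof -
  have "4 * k \<noteq> 2" by presburger
  then have "real (4 * k) \<noteq> real 2" by (simp only: of_nat_eq_iff not_False_eq_True)
  then show ?thesis by simp
qed

lemma eta_continuous: "continuous_on S (eta k)"
  unfolding eta_def[abs_def]
  by (intro continuous_intros legendre_continuous ballI eta_scale_neq_0)

lemma deriv_eta: "deriv (eta k) = eta' k"
proof
  fix x
  have "(eta k has_real_derivative eta' k x) (at x)"
    unfolding eta_def[abs_def] eta'_def
    by (rule DERIV_cdivide DERIV_diff legendre_has_deriv)+
  then show "deriv (eta k) x = eta' k x" by (rule DERIV_imp_deriv)
qed

lemma legendre_deriv_continuous: "continuous_on S (legendre_deriv n)"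
proof (induction n rule: induct_nat_012)
  case 0
  have "legendre_deriv 0 = (\<lambda>_. 0)" by (rule ext) simp
  then show ?case by simp
next
  case 1
  have "legendre_deriv (Suc 0) = (\<lambda>_. 1)" by (rule ext) simp
  then show ?case by simp
next
  case (ge2 n)
  have "legendre_deriv (Suc (Suc n)) = (\<lambda>x. ((2 * real n + 3) * (legendre (Suc n) x + x * legendre_deriv (Suc n) x)
       - (real n + 1) * legendre_deriv n x) / (real n + 2))"
    by (rule ext) simp
  then show ?case using ge2 by (auto intro!: continuous_intros legendre_continuous)
qed

lemma eta'_continuous: "continuous_on S (eta' k)"
  unfolding eta'_def[abs_def]
  by (intro continuous_intros legendre_deriv_continuous ballI eta_scale_neq_0)

lemma eta'_legendre: "1 \<le> n \<Longrightarrow> eta' (Suc n) x = - sqrt (real n + 1 / 2) * legendre n x"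
proof -
  assume "1 \<le> n"
  then obtain m where m: "n = Suc m" by (cases n) auto
  have e: "eta' (Suc n) x = - ((2 * real n + 1) / sqrt (4 * real n + 2)) * legendre n x"
    using legendre_deriv_diff[of m x] unfolding eta'_def m
    by (simp add: algebra_simps del: legendre.simps legendre_deriv.simps)
      (simp add: field_simps del: legendre.simps legendre_deriv.simps)
  have "(2 * real n + 1) / sqrt (4 * real n + 2) = sqrt (real n + 1 / 2)"
  proof -
    have "sqrt (real n + 1/2) * sqrt (4 * real n + 2) = sqrt ((2 * real n + 1)\<^sup>2)"
      by (subst real_sqrt_mult[symmetric]) (simp add: power2_eq_square algebra_simps)
    then show ?thesis by (simp add: field_simps)
  qed
  with e show ?thesis by simp
qed

lemma integral_eta'_sum_sq:
  assumes "v 0 = 0" "v 1 = 0"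
  shows "integral {-1..1} (\<lambda>x. (\<Sum>k<N. v k * eta' k x)\<^sup>2) = (\<Sum>k<N. (v k)\<^sup>2)"
proof (cases N)
  case (Suc M)
  have "v (Suc n) * eta' (Suc n) x = - (v (Suc n) * sqrt (real n + 1/2)) * legendre n x" for n x
    using assms eta'_legendre[of n x] by (cases n) auto
  then have "(\<Sum>k<N. v k * eta' k x) = (\<Sum>n<M. - (v (Suc n) * sqrt (real n + 1/2)) * legendre n x)" for x
    unfolding Suc sum.lessThan_Suc_shift using assms by (simp only: mult_zero_left add_0_left)
  then have "integral {-1..1} (\<lambda>x. (\<Sum>k<N. v k * eta' k x)\<^sup>2)
      = (\<Sum>n<M. (v (Suc n))\<^sup>2 * ((real n + 1/2) * (2 / (2 * real n + 1))))"
    by (simp only: integral_legendre_sum_sq) (simp add: power_mult_distrib mult.assoc)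
  also have "\<dots> = (\<Sum>n<M. (v (Suc n))\<^sup>2)"
    by (intro sum.cong refl) (simp add: field_simps)
  finally show ?thesis unfolding Suc sum.lessThan_Suc_shift using assms by simp
qed simp

lemma sum_shift_two:
  fixes g :: "nat \<Rightarrow> real"
  assumes "g 0 = 0" "g 1 = 0" "\<And>k. N \<le> k \<Longrightarrow> g k = 0"
  shows "(\<Sum>j<N. g (j + 2)) = (\<Sum>k<N. g k)"
proof -
  have "(\<Sum>j<N. g (j + 2)) = (\<Sum>k<Suc (Suc N). g k)"
    using assms by (simp add: sum.lessThan_Suc_shift del: sum.lessThan_Suc)
  also have "\<dots> = (\<Sum>k<N. g k)" using assms by simp
  finally show ?thesis .
qed

text \<open>With \<open>b k = v k / sqrt (4 k - 2)\<close> the \<open>L\<^sub>j\<close>-coefficient of \<open>\<Sum>k. v k \<eta>\<^sub>k\<close> is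
  \<open>b (j + 2) - b j\<close>. The parameter \<open>\<tau>\<close> weights Young's inequality for the only large
  off-diagonal coupling, between the indices 2 and 4.\<close>
lemma integral_eta_sum_sq_le:
  fixes v :: "nat \<Rightarrow> real"
  assumes v: "v 0 = 0" "v 1 = 0" and l: "0 < \<tau>" and d: "0 \<le> d"
    and q: "1 / 8 \<le> q" "(1 + \<tau>) / 35 + 2 / 63 \<le> q" "2 / 5 + 1 / (15 * \<tau>) \<le> q + d"
  shows "integral {-1..1} (\<lambda>x. (\<Sum>k<N. v k * eta k x)\<^sup>2) \<le> q * (\<Sum>k<N. (v k)\<^sup>2) + d * (v 2)\<^sup>2"
proof -
  \<comment> \<open>Cutting \<open>v\<close> off at \<open>N\<close> makes the index shift by 2
    exact, without boundary terms.\<close>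
  define w where "w k = (if k < N then v k else 0)" for k
  define b where "b k = w k / sqrt (4 * real k - 2)" for k
  have w0: "w 0 = 0" "w 1 = 0" and wN: "\<And>k. N \<le> k \<Longrightarrow> w k = 0" using v by (auto simp: w_def)
  have b2: "(b k)\<^sup>2 = (w k)\<^sup>2 / (4 * real k - 2)" for k
    by (cases "k = 0") (auto simp: b_def power_divide w0)
  have "(\<Sum>k<N. v k * eta k x) = (\<Sum>j<N. (b (j + 2) - b j) * legendre j x)" for x
  proof -
    have "(\<Sum>k<N. v k * eta k x) = (\<Sum>k<N. b k * legendre (k - 2) x) - (\<Sum>k<N. b k * legendre k x)"
      unfolding sum_subtractf[symmetric]
      by (intro sum.cong refl) (simp add: eta_def b_def w_def algebra_simps diff_divide_distrib)
    also have "(\<Sum>k<N. b k * legendre (k - 2) x) = (\<Sum>j<N. b (j + 2) * legendre j x)"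
      using sum_shift_two[of "\<lambda>k. b k * legendre (k - 2) x" N] w0 wN by (simp add: b_def)
    finally show ?thesis by (simp add: sum_subtractf algebra_simps)
  qed
  then have "integral {-1..1} (\<lambda>x. (\<Sum>k<N. v k * eta k x)\<^sup>2)
      = (\<Sum>j<N. (b (j + 2) - b j)\<^sup>2 * (2 / (2 * real j + 1)))"
    by (simp only: integral_legendre_sum_sq)
  \<comment> \<open>\<open>X k\<close> and \<open>Y k\<close> are the weights that the square of
    \<open>w k\<close> receives from the coefficients of L_(k-2) and of L_k. The factor 2 of Young's
    inequality is absent from \<open>X 2\<close> and \<open>X 3\<close> because \<open>b 0\<close>
    and \<open>b 1\<close> vanish; from \<open>j = 3\<close> on the inequality is used with weight
    1.\<close>
  define X where "X k = (if k = 2 then 1/3 else if k = 3 then 1/15 else if k = 4 then (1 + \<tau>) / 35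
      else 4 / ((2 * real k - 3) * (4 * real k - 2)))" for k :: nat
  define Y where "Y k = (if k = 2 then (1 + 1 / \<tau>) / 15
      else 4 / ((2 * real k + 1) * (4 * real k - 2)))" for k :: nat
  have term_le: "(b (j + 2) - b j)\<^sup>2 * (2 / (2 * real j + 1)) \<le> X (j + 2) * (w (j + 2))\<^sup>2 + Y j * (w j)\<^sup>2" for j
  proof -
    consider "j = 0" | "j = 1" | "j = 2" | "j \<ge> 3" by linarith
    then show ?thesis
    proof cases
      case 1
      have "b 0 = 0" using w0 by (simp add: b_def)
      moreover have "(0::nat) + 2 = 2" by simp
      ultimately show ?thesis unfolding 1 using b2[of 2] w0 by (simp add: X_def del: add_2_eq_Suc')
    next
      case 2
      have "b 1 = 0" using w0 by (simp add: b_def)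
      moreover have "(1::nat) + 2 = 3" by simp
      ultimately show ?thesis unfolding 2 using b2[of 3] w0 by (simp add: X_def del: add_2_eq_Suc add_2_eq_Suc')
    next
      case 3
      have "0 \<le> (\<tau> * b 4 + b 2)\<^sup>2 / \<tau>" using l by simp
      also have "\<dots> = (1 + \<tau>) * (b 4)\<^sup>2 + (1 + 1 / \<tau>) * (b 2)\<^sup>2 - (b 4 - b 2)\<^sup>2"
        using l by (simp add: field_simps power2_eq_square)
      finally have "(b 4 - b 2)\<^sup>2 \<le> (1 + \<tau>) * (b 4)\<^sup>2 + (1 + 1 / \<tau>) * (b 2)\<^sup>2"
        by simp
      then have "(b 4 - b 2)\<^sup>2 * (2/5) \<le> ((1 + \<tau>) * (b 4)\<^sup>2 + (1 + 1 / \<tau>) * (b 2)\<^sup>2) * (2/5)"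
        by (rule mult_right_mono) simp
      then show ?thesis unfolding 3 b2 X_def Y_def by (simp add: field_simps)
    next
      case 4
      have "(b (j + 2) - b j)\<^sup>2 \<le> 2 * (b (j + 2))\<^sup>2 + 2 * (b j)\<^sup>2"
        using zero_le_power2[of "b (j + 2) + b j"] by (simp add: power2_eq_square algebra_simps)
      then have "(b (j + 2) - b j)\<^sup>2 * (2 / (2 * real j + 1))
          \<le> (2 * (b (j + 2))\<^sup>2 + 2 * (b j)\<^sup>2) * (2 / (2 * real j + 1))"
        by (rule mult_right_mono) simp
      also have "\<dots> = X (j + 2) * (w (j + 2))\<^sup>2 + Y j * (w j)\<^sup>2"
        using 4 unfolding b2 X_def Y_def by (simp add: divide_simps) (simp add: algebra_simps)
      finally show ?thesis .
    qed
  qed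
  \<comment> \<open>The three assumptions on \<open>q\<close> bound \<open>X k + Y k\<close> at the
    indices 3 (where it is 13/105), 4 and 2, in this order; from index 5 on the sum is far below
    1/8.\<close>
  have coef: "(X k + Y k) * (w k)\<^sup>2 \<le> q * (w k)\<^sup>2 + (if k = 2 then d * (v 2)\<^sup>2 else 0)" for k
  proof -
    consider "k < 2" | "k = 2" | "k = 3" | "k = 4" | "k \<ge> 5" by linarith
    then show ?thesis
    proof cases
      case 1
      then have "k = 0 \<or> k = 1" by auto
      then show ?thesis using w0 by auto
    next
      case 2
      have "X k + Y k \<le> q + d" using q(3) 2 l by (simp add: X_def Y_def field_simps)
      then have "(X k + Y k) * (w k)\<^sup>2 \<le> (q + d) * (w k)\<^sup>2" by (rule mult_right_mono) simp
      moreover have "d * (w 2)\<^sup>2 \<le> d * (v 2)\<^sup>2" using d by (intro mult_left_mono) (auto simp: w_def)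
      ultimately show ?thesis using 2 by (simp add: algebra_simps)
    next
      case 3
      then have "X k + Y k \<le> q" using q(1) by (simp add: X_def Y_def)
      then show ?thesis using 3 by (simp add: mult_right_mono)
    next
      case 4
      then have "X k + Y k \<le> q" using q(2) by (simp add: X_def Y_def)
      then show ?thesis using 4 by (simp add: mult_right_mono)
    next
      case 5
      have "4 / ((2 * real k - 3) * (4 * real k - 2)) \<le> 4 / (7 * 18)"
        "4 / ((2 * real k + 1) * (4 * real k - 2)) \<le> 4 / (11 * 18)"
        using 5 by (intro divide_left_mono mult_mono mult_pos_pos; simp)+
      then have "X k \<le> 4 / (7 * 18)" "Y k \<le> 4 / (11 * 18)"
        using 5 by (simp_all add: X_def Y_def)
      then have "X k + Y k \<le> q" using q(1) by simp
      then show ?thesis using 5 by (simp add: mult_right_mono)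
    qed
  qed
  have "(\<Sum>j<N. (b (j + 2) - b j)\<^sup>2 * (2 / (2 * real j + 1)))
      \<le> (\<Sum>j<N. X (j + 2) * (w (j + 2))\<^sup>2) + (\<Sum>j<N. Y j * (w j)\<^sup>2)"
    unfolding sum.distrib[symmetric] by (rule sum_mono) (rule term_le)
  also have "(\<Sum>j<N. X (j + 2) * (w (j + 2))\<^sup>2) = (\<Sum>k<N. X k * (w k)\<^sup>2)"
    using sum_shift_two[of "\<lambda>k. X k * (w k)\<^sup>2" N] w0 wN by simp
  also have "(\<Sum>k<N. X k * (w k)\<^sup>2) + (\<Sum>j<N. Y j * (w j)\<^sup>2)
      \<le> (\<Sum>k<N. q * (w k)\<^sup>2 + (if k = 2 then d * (v 2)\<^sup>2 else 0))"
    unfolding sum.distrib[symmetric] by (rule sum_mono) (use coef in \<open>simp add: algebra_simps\<close>)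
  also have "\<dots> \<le> q * (\<Sum>k<N. (v k)\<^sup>2) + d * (v 2)\<^sup>2"
    using d by (simp add: sum.distrib sum_distrib_left w_def sum.delta)
  finally show ?thesis
    using \<open>integral _ _ = _\<close> by simp
qed

text \<open>The coefficients are controlled inside the interval only: they need not extend
  continuously to the end points, and their values there are arbitrary. A bounded measurable factor
  on the open interval suffices, as the end points are negligible.\<close>

lemma integrable_on_bounded_mult:
  fixes g h :: "real \<Rightarrow> real"
  assumes g: "continuous_on {a<..<b} g" "\<And>x. x \<in> {a<..<b} \<Longrightarrow> \<bar>g x\<bar> \<le> B"
    and h: "continuous_on {a..b} h"
  shows "(\<lambda>x. g x * h x) integrable_on {a..b}"
proof -
  have "(\<lambda>x. g x * h x) integrable_on {a<..<b}"
  proof (rule measurable_bounded_by_integrable_imp_integrable)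
    show "(\<lambda>x. g x * h x) \<in> borel_measurable (lebesgue_on {a<..<b})"
      by (intro continuous_imp_measurable_on_sets_lebesgue continuous_on_mult g(1)
          continuous_on_subset[OF h]) auto
    have "(\<lambda>x. B * \<bar>h x\<bar>) integrable_on {a..b}"
      by (intro integrable_continuous_interval continuous_intros h)
    then show "(\<lambda>x. B * \<bar>h x\<bar>) integrable_on {a<..<b}"
      by (simp add: integrable_on_open_interval_real)
    show "norm (g x * h x) \<le> B * \<bar>h x\<bar>" if "x \<in> {a<..<b}" for x
      using g(2)[OF that] by (simp add: abs_mult mult_right_mono)
  qed auto
  then show ?thesis by (simp add: integrable_on_open_interval_real)
qed

section \<open>Two-sided bounds for the stiffness form\<close>

context
  fixes nu sg :: "real \<Rightarrow> real" and nulo nuhi sghi :: real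
  assumes nu: "continuous_on {-1<..<1} nu" "\<And>x. x \<in> {-1<..<1} \<Longrightarrow> nulo \<le> nu x \<and> nu x \<le> nuhi"
    and sg: "continuous_on {-1<..<1} sg" "\<And>x. x \<in> {-1<..<1} \<Longrightarrow> 0 \<le> sg x \<and> sg x \<le> sghi"
    and nulo: "0 < nulo"
begin

lemma weighted_integrable:
  assumes "continuous_on {-1..1} h"
  shows "(\<lambda>x. nu x * h x) integrable_on {-1..1}" "(\<lambda>x. sg x * h x) integrable_on {-1..1}"
proof -
  show "(\<lambda>x. nu x * h x) integrable_on {-1..1}"
    using nu(2) nulo by (intro integrable_on_bounded_mult[OF nu(1) _ assms, of nuhi]) fastforce
  show "(\<lambda>x. sg x * h x) integrable_on {-1..1}"
    using sg(2) by (intro integrable_on_bounded_mult[OF sg(1) _ assms, of sghi]) fastforce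
qed

lemma stiff_form_eq_integral:
  "((\<lambda>x. nu x * (\<Sum>k<N. v k * eta' k x)\<^sup>2 + sg x * (\<Sum>k<N. v k * eta k x)\<^sup>2) has_integral
    (\<Sum>l<N. \<Sum>k<N. stiff nu sg l k * v k * v l)) {-1..1}"
proof -
  have "((\<lambda>x. (nu x * deriv (eta k) x * deriv (eta l) x + sg x * eta k x * eta l x) * v k * v l)
      has_integral stiff nu sg l k * v k * v l) {-1..1}" for k l
  proof -
    have "(\<lambda>x. nu x * (eta' k x * eta' l x) + sg x * (eta k x * eta l x)) integrable_on {-1..1}"
      by (intro integrable_add weighted_integrable continuous_intros eta_continuous eta'_continuous)
    then show ?thesis
      unfolding stiff_def deriv_eta
      by (intro has_integral_mult_left integrable_integral) (simp add: mult.assoc)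
  qed
  then have "((\<lambda>x. \<Sum>l<N. \<Sum>k<N. (nu x * deriv (eta k) x * deriv (eta l) x + sg x * eta k x * eta l x) * v k * v l)
      has_integral (\<Sum>l<N. \<Sum>k<N. stiff nu sg l k * v k * v l)) {-1..1}"
    by (intro has_integral_sum) auto
  moreover have "(\<Sum>l<N. \<Sum>k<N. (nu x * deriv (eta k) x * deriv (eta l) x + sg x * eta k x * eta l x) * v k * v l)
     = nu x * (\<Sum>k<N. v k * eta' k x)\<^sup>2 + sg x * (\<Sum>k<N. v k * eta k x)\<^sup>2" for x
    unfolding deriv_eta power2_eq_square sum_product
    unfolding sum_distrib_left sum.distrib[symmetric]
    by (intro sum.cong refl) (simp add: algebra_simps)
  ultimately show ?thesis by simp
qed

lemma eta_sum_sq_integrable: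
  "(\<lambda>x. (\<Sum>k<N. v k * eta' k x)\<^sup>2) integrable_on {-1..1}"
  "(\<lambda>x. (\<Sum>k<N. v k * eta k x)\<^sup>2) integrable_on {-1..1}"
  by (intro integrable_continuous_interval continuous_intros eta_continuous eta'_continuous)+

lemma stiff_form_lower:
  assumes "v 0 = 0" "v 1 = 0"
  shows "nulo * (\<Sum>k<N. (v k)\<^sup>2) \<le> (\<Sum>l<N. \<Sum>k<N. stiff nu sg l k * v k * v l)"
proof (rule has_integral_le)
  \<comment> \<open>The comparison takes place on the open interval, where the coefficient bounds
    are available.\<close>
  show "((\<lambda>x. nulo * (\<Sum>k<N. v k * eta' k x)\<^sup>2) has_integral nulo * (\<Sum>k<N. (v k)\<^sup>2)) {-1<..<1}"
    using has_integral_mult_right[OF integrable_integral[OF eta_sum_sq_integrable(1)]]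
    by (simp flip: has_integral_Icc_iff_Ioo integral_eta'_sum_sq[OF assms])
  show "((\<lambda>x. nu x * (\<Sum>k<N. v k * eta' k x)\<^sup>2 + sg x * (\<Sum>k<N. v k * eta k x)\<^sup>2) has_integral
    (\<Sum>l<N. \<Sum>k<N. stiff nu sg l k * v k * v l)) {-1<..<1}"
    using stiff_form_eq_integral by (simp flip: has_integral_Icc_iff_Ioo)
  show "nulo * (\<Sum>k<N. v k * eta' k x)\<^sup>2
      \<le> nu x * (\<Sum>k<N. v k * eta' k x)\<^sup>2 + sg x * (\<Sum>k<N. v k * eta k x)\<^sup>2" if "x \<in> {-1<..<1}" for x
    using nu(2)[OF that] sg(2)[OF that] by (intro add_increasing2 mult_right_mono) auto
qed

text \<open>Replacing both coefficients by their common bound leaves the full H1 inner product, in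
  coefficients the identity plus the mass matrix. The parameters of the mass bound stay free because
  two different choices are made later.\<close>

lemma stiff_form_upper:
  assumes v: "v 0 = 0" "v 1 = 0" and l: "0 < \<tau>" and d: "0 \<le> d"
    and q: "1 / 8 \<le> q" "(1 + \<tau>) / 35 + 2 / 63 \<le> q" "2 / 5 + 1 / (15 * \<tau>) \<le> q + d"
  shows "(\<Sum>l<N. \<Sum>k<N. stiff nu sg l k * v k * v l)
    \<le> max nuhi sghi * ((1 + q) * (\<Sum>k<N. (v k)\<^sup>2) + d * (v 2)\<^sup>2)"
proof -
  let ?M = "max nuhi sghi"
  have M: "0 \<le> ?M" using nu(2)[of 0] nulo by (auto intro: order_trans)
  have "(\<Sum>l<N. \<Sum>k<N. stiff nu sg l k * v k * v l)
    \<le> ?M * (\<Sum>k<N. (v k)\<^sup>2) + ?M * integral {-1..1} (\<lambda>x. (\<Sum>k<N. v k * eta k x)\<^sup>2)"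
  proof (rule has_integral_le)
    show "((\<lambda>x. nu x * (\<Sum>k<N. v k * eta' k x)\<^sup>2 + sg x * (\<Sum>k<N. v k * eta k x)\<^sup>2) has_integral
      (\<Sum>l<N. \<Sum>k<N. stiff nu sg l k * v k * v l)) {-1<..<1}"
      using stiff_form_eq_integral by (simp flip: has_integral_Icc_iff_Ioo)
    have "((\<lambda>x. ?M * (\<Sum>k<N. v k * eta' k x)\<^sup>2 + ?M * (\<Sum>k<N. v k * eta k x)\<^sup>2) has_integral
      ?M * integral {-1..1} (\<lambda>x. (\<Sum>k<N. v k * eta' k x)\<^sup>2) + ?M * integral {-1..1} (\<lambda>x. (\<Sum>k<N. v k * eta k x)\<^sup>2)) {-1..1}"
      by (intro has_integral_add has_integral_mult_right integrable_integral eta_sum_sq_integrable)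
    then show "((\<lambda>x. ?M * (\<Sum>k<N. v k * eta' k x)\<^sup>2 + ?M * (\<Sum>k<N. v k * eta k x)\<^sup>2) has_integral
      ?M * (\<Sum>k<N. (v k)\<^sup>2) + ?M * integral {-1..1} (\<lambda>x. (\<Sum>k<N. v k * eta k x)\<^sup>2)) {-1<..<1}"
      by (simp add: integral_eta'_sum_sq[OF v] flip: has_integral_Icc_iff_Ioo)
    show "nu x * (\<Sum>k<N. v k * eta' k x)\<^sup>2 + sg x * (\<Sum>k<N. v k * eta k x)\<^sup>2
      \<le> ?M * (\<Sum>k<N. v k * eta' k x)\<^sup>2 + ?M * (\<Sum>k<N. v k * eta k x)\<^sup>2" if "x \<in> {-1<..<1}" for x
      using nu(2)[OF that] sg(2)[OF that] by (intro add_mono mult_right_mono) auto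
  qed
  also have "\<dots> \<le> ?M * (\<Sum>k<N. (v k)\<^sup>2) + ?M * (q * (\<Sum>k<N. (v k)\<^sup>2) + d * (v 2)\<^sup>2)"
    using integral_eta_sum_sq_le[OF assms] M by (intro add_left_mono mult_left_mono)
  finally show ?thesis by (simp add: algebra_simps)
qed

end

lemma stiff_sym: "stiff nu sg l k = stiff nu sg k l"
  by (simp add: stiff_def mult.commute mult.left_commute)

section \<open>Square summable coefficient sequences\<close>

lemma seqV_summable_mult:
  assumes "seqV u" "seqV v" shows "summable (\<lambda>k. u k * v k)"
proof (rule summable_comparison_test)
  show "summable (\<lambda>k. (u k)\<^sup>2 + (v k)\<^sup>2)"
    using assms by (auto simp: seqV_def intro: summable_add)
  show "\<exists>N. \<forall>n\<ge>N. norm (u n * v n) \<le> (u n)\<^sup>2 + (v n)\<^sup>2"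
  proof (intro exI allI impI)
    fix n
    have "0 \<le> (\<bar>u n\<bar> - \<bar>v n\<bar>)\<^sup>2" "0 \<le> \<bar>u n\<bar> * \<bar>v n\<bar>" by simp_all
    then show "norm (u n * v n) \<le> (u n)\<^sup>2 + (v n)\<^sup>2"
      unfolding power2_diff real_norm_def abs_mult power2_abs by linarith
  qed
qed

lemma seqV_lincomb:
  assumes "seqV u" "seqV v" shows "seqV (\<lambda>k. a * u k + b * v k)"
proof -
  have "summable (\<lambda>k. a\<^sup>2 * (u k)\<^sup>2 + 2 * a * b * (u k * v k) + b\<^sup>2 * (v k)\<^sup>2)"
    using assms seqV_summable_mult[OF assms]
    by (intro summable_add summable_mult) (auto simp: seqV_def)
  then have "summable (\<lambda>k. (a * u k + b * v k)\<^sup>2)"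
    by (rule summable_cong[THEN iffD1, rotated])
      (simp add: power2_eq_square algebra_simps)
  then show ?thesis using assms by (simp add: seqV_def)
qed

lemma seqV_add: "seqV u \<Longrightarrow> seqV v \<Longrightarrow> seqV (\<lambda>k. u k + v k)"
  using seqV_lincomb[of u v 1 1] by simp

lemma seqV_diff: "seqV u \<Longrightarrow> seqV v \<Longrightarrow> seqV (\<lambda>k. u k - v k)"
  using seqV_lincomb[of u v 1 "-1"] by simp

lemma seqV_scale: "seqV u \<Longrightarrow> seqV (\<lambda>k. c * u k)"
  using seqV_lincomb[of u u c 0] by simp

lemma seqV_zero: "seqV (\<lambda>_. 0)"
  by (simp add: seqV_def)

lemma seqV_finite_support:
  assumes "finite S" "\<And>k. k \<notin> S \<Longrightarrow> v k = 0" "v 0 = 0" "v 1 = 0" shows "seqV v"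
  using assms summable_finite[of S "\<lambda>k. (v k)\<^sup>2"] by (simp add: seqV_def)

lemma seqV_unitv: "2 \<le> j \<Longrightarrow> seqV (unitv j)"
  by (rule seqV_finite_support[of "{j}"]) (auto simp: unitv_def)

lemma seqV_proj: "seqV v \<Longrightarrow> seqV (proj S v)"
  unfolding seqV_def proj_def
  by (auto intro: summable_comparison_test[of _ "\<lambda>k. (v k)\<^sup>2"])

section \<open>Pairing, norm and completeness of l2\<close>

lemma dual_commute: "dual u v = dual v u"
  by (simp add: dual_def mult.commute)

lemma dual_lincomb:
  assumes "seqV u" "seqV v" "seqV w"
  shows "dual (\<lambda>k. a * u k + b * v k) w = a * dual u w + b * dual v w"
proof -
  note s = seqV_summable_mult[OF assms(1,3)] seqV_summable_mult[OF assms(2,3)]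
  have "dual (\<lambda>k. a * u k + b * v k) w = (\<Sum>k. a * (u k * w k) + b * (v k * w k))"
    unfolding dual_def by (simp add: algebra_simps)
  also have "\<dots> = (\<Sum>k. a * (u k * w k)) + (\<Sum>k. b * (v k * w k))"
    using s by (intro suminf_add[symmetric] summable_mult)
  also have "\<dots> = a * dual u w + b * dual v w"
    using s by (simp add: dual_def suminf_mult)
  finally show ?thesis .
qed

lemma dual_scale: "\<lbrakk>seqV u; seqV w\<rbrakk> \<Longrightarrow> dual (\<lambda>k. c * u k) w = c * dual u w"
  using dual_lincomb[of u u w c 0] by simp

lemma dual_self_nonneg: "seqV v \<Longrightarrow> 0 \<le> dual v v"
  unfolding dual_def by (rule suminf_nonneg[OF seqV_summable_mult]) auto

lemma nrm_sq: "seqV v \<Longrightarrow> (nrm v)\<^sup>2 = dual v v"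
  using dual_self_nonneg[of v] by (simp add: nrm_def dual_def power2_eq_square)

lemma nrm_dual: "nrm v = sqrt (dual v v)"
  by (simp add: nrm_def dual_def power2_eq_square)

lemma nrm_nonneg: "seqV v \<Longrightarrow> 0 \<le> nrm v"
  using dual_self_nonneg[of v] by (simp add: nrm_dual)

lemma dual_partial_le:
  assumes "seqV v" shows "(\<Sum>k<N. (v k)\<^sup>2) \<le> dual v v"
  using sum_le_suminf[OF seqV_summable_mult[OF assms assms], of "{..<N}"]
  by (simp add: dual_def power2_eq_square)

lemma component_le_dual: "seqV v \<Longrightarrow> (v k)\<^sup>2 \<le> dual v v"
  using dual_partial_le[of v "Suc k"] sum_nonneg[of "{..<k}" "\<lambda>k. (v k)\<^sup>2"] by simp

lemma dual_partial_tendsto: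
  assumes "seqV u" "seqV v" shows "(\<lambda>N. \<Sum>k<N. u k * v k) \<longlonglongrightarrow> dual u v"
  using summable_LIMSEQ[OF seqV_summable_mult[OF assms]] by (simp add: dual_def)

lemma seqV_bounded_partial:
  assumes "\<And>N. (\<Sum>k<N. (v k)\<^sup>2) \<le> B" "v 0 = 0" "v 1 = 0"
  shows "seqV v" "dual v v \<le> B"
proof -
  have s: "summable (\<lambda>k. (v k)\<^sup>2)"
    using bounded_imp_summable[of "\<lambda>k. (v k)\<^sup>2" B] assms(1)[of "Suc _"]
    by (auto simp: lessThan_Suc_atMost)
  then show v: "seqV v" using assms by (simp add: seqV_def)
  show "dual v v \<le> B"
    using suminf_le_const[OF s assms(1)] by (simp add: dual_def power2_eq_square)
qed

text \<open>Abstracted from any form, so that it serves finite sections, the l2 pairing and the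
  energy alike. In the degenerate case the chosen \<open>t\<close> would make the quadratic equal to
  -1.\<close>

lemma cauchy_schwarz_discriminant:
  fixes P B Q :: real
  assumes "\<And>t. 0 \<le> P + 2 * t * B + t\<^sup>2 * Q" "0 \<le> Q"
  shows "B\<^sup>2 \<le> P * Q"
proof (cases "Q = 0")
  case True
  have "B = 0"
  proof (rule ccontr)
    assume "B \<noteq> 0"
    then show False using assms(1)[of "- (P + 1) / (2 * B)"] True by (simp add: field_simps)
  qed
  then show ?thesis using True by simp
next
  case False
  then have "Q * (P + 2 * (- B / Q) * B + (- B / Q)\<^sup>2 * Q) = P * Q - B\<^sup>2"
    by (simp add: field_simps power2_eq_square)
  moreover have "0 \<le> Q * (P + 2 * (- B / Q) * B + (- B / Q)\<^sup>2 * Q)"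
    using assms(1)[of "- B / Q"] assms(2) by (rule mult_nonneg_nonneg[rotated])
  ultimately show ?thesis by simp
qed

lemma dual_combination_self:
  assumes "seqV u" "seqV v"
  shows "dual (\<lambda>k. a * u k + b * v k) (\<lambda>k. a * u k + b * v k)
    = a\<^sup>2 * dual u u + 2 * a * b * dual u v + b\<^sup>2 * dual v v"
proof -
  let ?w = "\<lambda>k. a * u k + b * v k"
  have "dual ?w ?w = a * dual u ?w + b * dual v ?w"
    by (intro dual_lincomb seqV_lincomb assms)
  also have "dual u ?w = a * dual u u + b * dual u v"
    using dual_lincomb[OF assms assms(1)] by (simp add: dual_commute)
  also have "dual v ?w = a * dual u v + b * dual v v"
    using dual_lincomb[OF assms assms(2)] by (simp add: dual_commute)
  finally show ?thesis by (simp add: algebra_simps power2_eq_square)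
qed

lemma dual_cauchy_schwarz_sq:
  assumes "seqV u" "seqV v" shows "(dual u v)\<^sup>2 \<le> dual u u * dual v v"
proof (rule cauchy_schwarz_discriminant)
  show "0 \<le> dual u u + 2 * t * dual u v + t\<^sup>2 * dual v v" for t
    using dual_combination_self[OF assms, of 1 t]
      dual_self_nonneg[OF seqV_lincomb[OF assms, of 1 t]] by simp
qed (use assms dual_self_nonneg in auto)

lemma dual_le_nrm:
  assumes "seqV u" "seqV v" shows "\<bar>dual u v\<bar> \<le> nrm u * nrm v"
  using real_sqrt_le_mono[OF dual_cauchy_schwarz_sq[OF assms]]
  by (simp add: nrm_dual real_sqrt_mult)

lemma nrm_triangle:
  assumes "seqV u" "seqV v" shows "nrm (\<lambda>k. u k + v k) \<le> nrm u + nrm v"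
proof (rule power2_le_imp_le)
  have "(nrm (\<lambda>k. u k + v k))\<^sup>2 = (nrm u)\<^sup>2 + 2 * dual u v + (nrm v)\<^sup>2"
    using dual_combination_self[OF assms, of 1 1] assms by (simp add: nrm_sq seqV_add)
  also have "\<dots> \<le> (nrm u + nrm v)\<^sup>2"
    using dual_le_nrm[OF assms] by (simp add: power2_sum)
  finally show "(nrm (\<lambda>k. u k + v k))\<^sup>2 \<le> (nrm u + nrm v)\<^sup>2" .
qed (simp add: nrm_nonneg assms)

lemma proj_orthogonal: "dual (proj S v) (\<lambda>k. v k - proj S v k) = 0"
  by (auto simp: dual_def proj_def intro!: trans[OF suminf_cong suminf_zero])

lemma proj_pythagoras:
  assumes "seqV v"
  shows "dual v v = dual (proj S v) (proj S v) + dual (\<lambda>k. v k - proj S v k) (\<lambda>k. v k - proj S v k)"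
  using dual_combination_self[of "proj S v" "\<lambda>k. v k - proj S v k" 1 1] assms proj_orthogonal[of S v]
  by (simp add: seqV_proj seqV_diff)

lemma truncation_tendsto:
  assumes "seqV v" shows "(\<lambda>N. nrm (\<lambda>k. v k - proj {..<N} v k)) \<longlonglongrightarrow> 0"
proof -
  have "dual (\<lambda>k. v k - proj {..<N} v k) (\<lambda>k. v k - proj {..<N} v k) = dual v v - (\<Sum>k<N. v k * v k)" for N
  proof -
    have "dual (proj {..<N} v) (proj {..<N} v) = (\<Sum>k<N. v k * v k)"
      unfolding dual_def by (subst suminf_finite[of "{..<N}"]) (auto simp: proj_def)
    then show ?thesis using proj_pythagoras[OF assms, of "{..<N}"] by simp
  qed
  moreover have "(\<lambda>N. sqrt (dual v v - (\<Sum>k<N. v k * v k))) \<longlonglongrightarrow> sqrt (dual v v - dual v v)"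
    by (intro tendsto_intros dual_partial_tendsto assms)
  ultimately show ?thesis by (simp add: nrm_dual)
qed

text \<open>Components converge, and the Cauchy modulus passes to the limit in every partial sum,
  hence to the norm. Keeping the modulus explicit gives the rate for the limit at once.\<close>

lemma ell2_complete:
  fixes S :: "nat \<Rightarrow> nat \<Rightarrow> real"
  assumes S: "\<And>n. seqV (S n)" and \<epsilon>: "\<epsilon> \<longlonglongrightarrow> 0"
    and cauchy: "\<And>m n. n \<le> m \<Longrightarrow> nrm (\<lambda>k. S m k - S n k) \<le> \<epsilon> n"
  obtains x where "seqV x" "\<And>n. nrm (\<lambda>k. x k - S n k) \<le> \<epsilon> n"
proof -
  have comp: "\<bar>S m k - S n k\<bar> \<le> \<epsilon> n" if "n \<le> m" for m n k
  proof -
    have "(S m k - S n k)\<^sup>2 \<le> (nrm (\<lambda>k. S m k - S n k))\<^sup>2"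
      using component_le_dual[OF seqV_diff[OF S S]] by (simp add: nrm_sq seqV_diff S)
    then have "\<bar>S m k - S n k\<bar> \<le> nrm (\<lambda>k. S m k - S n k)"
      using nrm_nonneg[OF seqV_diff[OF S S]] by (metis abs_le_square_iff abs_of_nonneg)
    then show ?thesis using cauchy[OF that] by linarith
  qed
  have "convergent (\<lambda>n. S n k)" for k
  proof (rule Cauchy_convergent, rule metric_CauchyI)
    fix e :: real assume "0 < e"
    then obtain n0 where n0: "\<And>n. n \<ge> n0 \<Longrightarrow> \<bar>\<epsilon> n\<bar> < e / 2"
      using \<epsilon> by (metis LIMSEQ_def dist_real_def diff_zero half_gt_zero)
    have "dist (S m k) (S n k) < e" if "m \<ge> n0" "n \<ge> n0" for m n
      using comp[OF that(1), of k] comp[OF that(2), of k] n0[of n0] by (simp add: dist_real_def)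
    then show "\<exists>M. \<forall>m\<ge>M. \<forall>n\<ge>M. dist (S m k) (S n k) < e" by blast
  qed
  then obtain x where x: "\<And>k. (\<lambda>n. S n k) \<longlonglongrightarrow> x k"
    unfolding convergent_def by metis
  have part: "(\<Sum>k<N. (x k - S n k)\<^sup>2) \<le> (\<epsilon> n)\<^sup>2" for n N
  proof (rule LIMSEQ_le_const2)
    show "(\<lambda>m. \<Sum>k<N. (S m k - S n k)\<^sup>2) \<longlonglongrightarrow> (\<Sum>k<N. (x k - S n k)\<^sup>2)"
      by (intro tendsto_intros x)
    have "(\<Sum>k<N. (S m k - S n k)\<^sup>2) \<le> (\<epsilon> n)\<^sup>2" if "n \<le> m" for m
    proof -
      have "(\<Sum>k<N. (S m k - S n k)\<^sup>2) \<le> (nrm (\<lambda>k. S m k - S n k))\<^sup>2"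
        using dual_partial_le[OF seqV_diff[OF S S]] by (simp add: nrm_sq seqV_diff S)
      also have "\<dots> \<le> (\<epsilon> n)\<^sup>2" using cauchy[OF that] nrm_nonneg[OF seqV_diff[OF S S]] by (intro power_mono)
      finally show ?thesis .
    qed
    then show "\<exists>M. \<forall>m\<ge>M. (\<Sum>k<N. (S m k - S n k)\<^sup>2) \<le> (\<epsilon> n)\<^sup>2" by blast
  qed
  have "(\<lambda>n. S n 0) = (\<lambda>_. 0)" "(\<lambda>n. S n 1) = (\<lambda>_. 0)"
    using S by (auto simp: seqV_def)
  then have x01: "x 0 = 0" "x 1 = 0"
    using x[of 0] x[of 1] by (auto simp: LIMSEQ_const_iff)
  have e0: "0 \<le> \<epsilon> n" for n using cauchy[of n n] nrm_nonneg[OF seqV_diff[OF S S]] order_trans by blast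
  have S01: "S n 0 = 0" "S n 1 = 0" for n using S[of n] by (auto simp: seqV_def)
  have d: "seqV (\<lambda>k. x k - S n k)" "dual (\<lambda>k. x k - S n k) (\<lambda>k. x k - S n k) \<le> (\<epsilon> n)\<^sup>2" for n
    using seqV_bounded_partial[of "\<lambda>k. x k - S n k", OF part[of n]] x01 S01 by auto
  show ?thesis
  proof
    show "seqV x" using seqV_add[OF d(1)[of 0] S[of 0]] by simp
    show "nrm (\<lambda>k. x k - S n k) \<le> \<epsilon> n" for n
      using real_sqrt_le_mono[OF d(2)[of n]] e0[of n] by (simp add: nrm_dual)
  qed
qed

section \<open>Coercive matrices\<close>

lemma mat_app_lt_2 [simp]: "mat_app B w 0 = 0" "mat_app B w (Suc 0) = 0"
  by (simp_all add: mat_app_def)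

text \<open>The bounds are assumed for finite sections because only finite sums of basis functions
  are integrated. The first two entries of \<open>v\<close> vanish since the basis starts at index
  2.\<close>

locale coercive_matrix =
  fixes A :: "nat \<Rightarrow> nat \<Rightarrow> real" and a C :: real
  assumes sym: "A l k = A k l"
    and a_pos: "0 < a"
    and C_pos: "0 < C"
    and form_lower: "\<And>v N. \<lbrakk>v 0 = 0; v 1 = 0\<rbrakk> \<Longrightarrow>
      a * (\<Sum>k<N. (v k)\<^sup>2) \<le> (\<Sum>l<N. \<Sum>k<N. A l k * v k * v l)"
    and form_upper: "\<And>v N. \<lbrakk>v 0 = 0; v 1 = 0\<rbrakk> \<Longrightarrow>
      (\<Sum>l<N. \<Sum>k<N. A l k * v k * v l) \<le> C * (\<Sum>k<N. (v k)\<^sup>2)"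
begin

definition form :: "nat \<Rightarrow> (nat \<Rightarrow> real) \<Rightarrow> (nat \<Rightarrow> real) \<Rightarrow> real" where
  "form N w v = (\<Sum>l<N. \<Sum>k<N. A l k * w k * v l)"

lemma form_nonneg: "\<lbrakk>v 0 = 0; v 1 = 0\<rbrakk> \<Longrightarrow> 0 \<le> form N v v"
  using form_lower[of v N] a_pos sum_nonneg[of "{..<N}" "\<lambda>k. (v k)\<^sup>2"]
  by (simp add: form_def) (meson mult_nonneg_nonneg less_imp_le order_trans zero_le_power2)

lemma form_commute: "form N w v = form N v w"
proof -
  have "form N w v = (\<Sum>k<N. \<Sum>l<N. A l k * w k * v l)"
    unfolding form_def by (rule sum.swap)
  then show ?thesis
    by (simp add: form_def sym mult.commute mult.left_commute)
qed

lemma form_combination: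
  "form N (\<lambda>k. w k + t * v k) (\<lambda>k. w k + t * v k) = form N w w + 2 * t * form N w v + t\<^sup>2 * form N v v"
proof -
  have "form N (\<lambda>k. w k + t * v k) (\<lambda>k. w k + t * v k)
      = form N w w + t * form N w v + t * form N v w + t\<^sup>2 * form N v v"
    unfolding form_def sum_distrib_left sum.distrib[symmetric]
    by (intro sum.cong refl) (simp add: algebra_simps power2_eq_square)
  then show ?thesis using form_commute[of N w v] by simp
qed

lemma form_bounded:
  assumes "w 0 = 0" "w 1 = 0" "v 0 = 0" "v 1 = 0"
  shows "(form N w v)\<^sup>2 \<le> C\<^sup>2 * (\<Sum>k<N. (w k)\<^sup>2) * (\<Sum>k<N. (v k)\<^sup>2)"
proof -
  have "(form N w v)\<^sup>2 \<le> form N w w * form N v v"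
  proof (rule cauchy_schwarz_discriminant)
    show "0 \<le> form N w w + 2 * t * form N w v + t\<^sup>2 * form N v v" for t
      unfolding form_combination[symmetric] using assms by (intro form_nonneg) auto
  qed (use assms form_nonneg in auto)
  also have "\<dots> \<le> (C * (\<Sum>k<N. (w k)\<^sup>2)) * (C * (\<Sum>k<N. (v k)\<^sup>2))"
    using assms C_pos form_nonneg form_upper[of w N] form_upper[of v N] unfolding form_def
    by (intro mult_mono) (auto intro!: mult_nonneg_nonneg sum_nonneg)
  finally show ?thesis by (simp add: power2_eq_square algebra_simps)
qed

definition row :: "nat \<Rightarrow> nat \<Rightarrow> real" where
  "row l k = (if k < 2 then 0 else A l k)"

text \<open>Pairing the truncated row with the unit vector reproduces its square sum
  \<open>?S\<close>, so \<open>form_bounded\<close> gives \<open>?S * ?S\<close> at most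
  \<open>C\<^sup>2 * ?S\<close>. This is what makes the series in \<open>mat_app\<close>
  converge.\<close>

lemma seqV_row:
  assumes "2 \<le> l" shows "seqV (row l)"
proof (rule seqV_bounded_partial)
  fix N
  have sq: "(\<Sum>k<N. (row l k)\<^sup>2) \<le> C\<^sup>2" if "l < N" for N :: nat
  proof -
    let ?S = "\<Sum>k<N. (row l k)\<^sup>2"
    have "form N (row l) (unitv l) = (\<Sum>m<N. if m = l then \<Sum>k<N. A m k * row l k else 0)"
      unfolding form_def unitv_def by (intro sum.cong refl) auto
    also have "\<dots> = ?S"
      using that by (auto simp: sum.delta row_def power2_eq_square intro!: sum.cong)
    finally have "form N (row l) (unitv l) = ?S" .
    moreover have "(\<Sum>k<N. (unitv l k)\<^sup>2) = 1"
      using that by (simp add: unitv_def if_distrib[of "\<lambda>x. x\<^sup>2"] cong: if_cong)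
    ultimately have "?S * ?S \<le> C\<^sup>2 * ?S"
      using form_bounded[of "row l" "unitv l" N] assms by (simp add: row_def unitv_def power2_eq_square)
    moreover have "0 \<le> ?S" by (intro sum_nonneg) simp
    ultimately show ?thesis by (cases "?S = 0") (auto simp: mult_le_cancel_right)
  qed
  have "(\<Sum>k<N. (row l k)\<^sup>2) \<le> (\<Sum>k<max N (Suc l). (row l k)\<^sup>2)"
    by (intro sum_mono2) auto
  then show "(\<Sum>k<N. (row l k)\<^sup>2) \<le> C\<^sup>2" using sq[of "max N (Suc l)"] by linarith
qed (simp_all add: row_def)

lemma mat_app_row:
  assumes "seqV w" "2 \<le> l" shows "mat_app A w l = dual (row l) w"
proof -
  have "(\<Sum>k. A l (k + 2) * w (k + 2)) = (\<Sum>k. row l (k + 2) * w (k + 2))"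
    by (simp add: row_def)
  also have "\<dots> = dual (row l) w"
    using suminf_split_initial_segment[OF seqV_summable_mult[OF seqV_row[OF assms(2)] assms(1)], of 2]
    by (simp add: dual_def row_def numeral_2_eq_2)
  finally show ?thesis using assms(2) by (simp add: mat_app_def)
qed

lemma mat_app_lincomb:
  assumes "seqV u" "seqV v"
  shows "mat_app A (\<lambda>k. c * u k + d * v k) l = c * mat_app A u l + d * mat_app A v l"
proof (cases "l < 2")
  case False
  then have l: "2 \<le> l" by simp
  show ?thesis
    using dual_lincomb[OF assms seqV_row[OF l], of c d] l assms
    by (simp add: mat_app_row seqV_lincomb dual_commute[of "row l"])
qed (simp add: mat_app_def)

text \<open>The outer sum stays cut off at \<open>N\<close> while the inner length \<open>K\<close>
  grows, so finite bounds reach \<open>mat_app\<close> before its square summability is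
  known.\<close>

lemma partial_form_tendsto:
  assumes "seqV w" "v 0 = 0" "v 1 = 0"
  shows "(\<lambda>K. form K w (proj {..<N} v)) \<longlonglongrightarrow> (\<Sum>l<N. v l * mat_app A w l)"
proof -
  have "(\<lambda>K. \<Sum>l<N. v l * (\<Sum>k<K. row l k * w k)) \<longlonglongrightarrow> (\<Sum>l<N. v l * mat_app A w l)"
  proof (intro tendsto_sum)
    fix l
    show "(\<lambda>K. v l * (\<Sum>k<K. row l k * w k)) \<longlonglongrightarrow> v l * mat_app A w l"
    proof (cases "l < 2")
      case True
      then have "l = 0 \<or> l = 1" by auto
      then show ?thesis using assms by auto
    next
      case False
      then show ?thesis
        using assms(1) by (intro tendsto_mult_left) (simp add: mat_app_row dual_partial_tendsto seqV_row)
    qed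
  qed
  moreover have "eventually (\<lambda>K. (\<Sum>l<N. v l * (\<Sum>k<K. row l k * w k)) = form K w (proj {..<N} v)) sequentially"
    using eventually_ge_at_top[of N]
  proof eventually_elim
    case (elim K)
    have row: "w k * row l k = w k * A l k" for l k
      using assms(1) by (cases "k = 0 \<or> k = 1") (auto simp: row_def seqV_def)
    have "form K w (proj {..<N} v) = (\<Sum>l<K. if l \<in> {..<N} then \<Sum>k<K. A l k * w k * v l else 0)"
      unfolding form_def proj_def by (intro sum.cong refl) auto
    also have "\<dots> = (\<Sum>l<N. \<Sum>k<K. A l k * w k * v l)"
      using elim by (subst sum.inter_restrict[symmetric]) (auto intro!: sum.cong)
    finally show ?case by (simp add: row sum_distrib_left mult_ac)
  qed
  ultimately show ?thesis by (rule Lim_transform_eventually)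
qed

text \<open>The form is tested with the truncation of the image itself; one factor \<open>?S\<close>
  then cancels.\<close>

lemma mat_app_bounded:
  assumes w: "seqV w"
  shows "seqV (mat_app A w)" "nrm (mat_app A w) \<le> C * nrm w"
proof -
  let ?v = "mat_app A w"
  have "(\<Sum>l<N. (?v l)\<^sup>2) \<le> C\<^sup>2 * dual w w" for N
  proof -
    let ?S = "\<Sum>l<N. (?v l)\<^sup>2"
    have "(\<lambda>K. (form K w (proj {..<N} ?v))\<^sup>2) \<longlonglongrightarrow> (\<Sum>l<N. ?v l * ?v l)\<^sup>2"
      by (intro tendsto_power partial_form_tendsto w) auto
    moreover have "(form K w (proj {..<N} ?v))\<^sup>2 \<le> C\<^sup>2 * dual w w * ?S" for K
    proof -
      have "(form K w (proj {..<N} ?v))\<^sup>2 \<le> C\<^sup>2 * (\<Sum>k<K. (w k)\<^sup>2) * (\<Sum>k<K. (proj {..<N} ?v k)\<^sup>2)"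
        using w by (intro form_bounded) (auto simp: proj_def seqV_def)
      also have "\<dots> \<le> C\<^sup>2 * dual w w * ?S"
      proof (intro mult_mono dual_partial_le w order_refl)
        have "(\<Sum>k<K. (proj {..<N} ?v k)\<^sup>2) = (\<Sum>k\<in>{..<K} \<inter> {..<N}. (?v k)\<^sup>2)"
          by (subst sum.inter_restrict) (auto simp: proj_def intro!: sum.cong)
        also have "\<dots> \<le> ?S" by (intro sum_mono2) auto
        finally show "(\<Sum>k<K. (proj {..<N} ?v k)\<^sup>2) \<le> ?S" .
      qed (use dual_self_nonneg[OF w] in \<open>auto intro!: sum_nonneg mult_nonneg_nonneg\<close>)
      finally show ?thesis .
    qed
    ultimately have "(\<Sum>l<N. ?v l * ?v l)\<^sup>2 \<le> C\<^sup>2 * dual w w * ?S"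
      by (intro LIMSEQ_le_const2) auto
    then have "?S * ?S \<le> C\<^sup>2 * dual w w * ?S" by (simp add: power2_eq_square)
    moreover have "0 \<le> ?S" by (intro sum_nonneg) simp
    moreover have "0 \<le> C\<^sup>2 * dual w w" using dual_self_nonneg[OF w] by simp
    ultimately show ?thesis by (cases "?S = 0") (auto simp: mult_le_cancel_right)
  qed
  from seqV_bounded_partial[of ?v, OF this]
  have "seqV ?v" "dual ?v ?v \<le> C\<^sup>2 * dual w w" by auto
  then show "seqV ?v" "nrm ?v \<le> C * nrm w"
    using real_sqrt_le_mono[of "dual ?v ?v" "C\<^sup>2 * dual w w"] C_pos
    by (auto simp: nrm_dual real_sqrt_mult)
qed

lemma abil_dual: "abil A w v = dual v (mat_app A w)"
  by (simp add: abil_def dual_def)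

lemma abil_lincomb_left:
  assumes "seqV u" "seqV v" "seqV w"
  shows "abil A (\<lambda>k. c * u k + d * v k) w = c * abil A u w + d * abil A v w"
  using dual_lincomb[of "mat_app A u" "mat_app A v" w c d] assms mat_app_bounded(1)
  by (simp add: abil_dual ext[OF mat_app_lincomb] dual_commute[of w])

lemma abil_lincomb_right:
  assumes "seqV u" "seqV v" "seqV w"
  shows "abil A w (\<lambda>k. c * u k + d * v k) = c * abil A w u + d * abil A w v"
  using assms mat_app_bounded(1) by (simp add: abil_dual dual_lincomb)

lemma abil_bounded:
  assumes "seqV w" "seqV v" shows "\<bar>abil A w v\<bar> \<le> C * nrm w * nrm v"
proof -
  have "\<bar>abil A w v\<bar> \<le> nrm v * nrm (mat_app A w)"
    using assms mat_app_bounded(1) by (simp add: abil_dual dual_le_nrm)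
  also have "\<dots> \<le> nrm v * (C * nrm w)"
    using assms by (intro mult_left_mono mat_app_bounded nrm_nonneg)
  finally show ?thesis by (simp add: mult.commute mult.left_commute)
qed

text \<open>\<open>form N w v\<close> is \<open>abil\<close> at the two truncated sequences, so this
  is joint continuity of \<open>abil\<close>. Symmetry, coercivity and upper bounds are inherited
  from the finite sections in this way.\<close>

lemma form_tendsto_abil:
  assumes w: "seqV w" and v: "seqV v" shows "(\<lambda>N. form N w v) \<longlonglongrightarrow> abil A w v"
proof -
  let ?w = "\<lambda>N. proj {..<N} w" and ?v = "\<lambda>N. proj {..<N} v"
  have form: "abil A (?w N) (?v N) = form N w v" for N
  proof -
    have "mat_app A (?w N) l = (\<Sum>k<N. A l k * w k)" if "2 \<le> l" for l
    proof -
      have "mat_app A (?w N) l = (\<Sum>k<N. row l k * ?w N k)"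
        using that w unfolding mat_app_row[OF seqV_proj[OF w] that] dual_def
        by (intro suminf_finite) (auto simp: proj_def)
      also have "\<dots> = (\<Sum>k<N. A l k * w k)"
        using w by (intro sum.cong refl)
          (auto simp: proj_def row_def seqV_def less_2_cases_iff)
      finally show ?thesis .
    qed
    moreover have "v l = 0" if "\<not> 2 \<le> l" for l
      using that v by (cases "l = 0 \<or> l = 1") (auto simp: seqV_def)
    ultimately have "?v N l * mat_app A (?w N) l = (if l \<in> {..<N} then v l * (\<Sum>k<N. A l k * w k) else 0)" for l
      by (cases "2 \<le> l") (auto simp: proj_def)
    then have "abil A (?w N) (?v N) = (\<Sum>l. if l \<in> {..<N} then v l * (\<Sum>k<N. A l k * w k) else 0)"
      unfolding abil_def by simp
    also have "\<dots> = (\<Sum>l<N. v l * (\<Sum>k<N. A l k * w k))"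
      by (subst suminf_finite[of "{..<N}"]) auto
    finally show ?thesis by (simp add: form_def sum_distrib_left sum_distrib_right mult.commute)
  qed
  have "norm (abil A (?w N) (?v N) - abil A w v)
      \<le> C * nrm (\<lambda>k. w k - ?w N k) * nrm v + C * nrm w * nrm (\<lambda>k. v k - ?v N k)" for N
  proof -
    have w': "seqV (?w N)" "seqV (\<lambda>k. w k - ?w N k)" and v': "seqV (?v N)" "seqV (\<lambda>k. v k - ?v N k)"
      using w v by (auto intro: seqV_proj seqV_diff)
    have "abil A (\<lambda>k. w k - ?w N k) (?v N) = abil A w (?v N) - abil A (?w N) (?v N)"
      using abil_lincomb_left[OF w w'(1) v'(1), of 1 "-1"] by simp
    moreover have "abil A w (\<lambda>k. v k - ?v N k) = abil A w v - abil A w (?v N)"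
      using abil_lincomb_right[OF v v'(1) w, of 1 "-1"] by simp
    ultimately have "norm (abil A (?w N) (?v N) - abil A w v)
        \<le> \<bar>abil A (\<lambda>k. w k - ?w N k) (?v N)\<bar> + \<bar>abil A w (\<lambda>k. v k - ?v N k)\<bar>"
      by simp
    also have "\<dots> \<le> C * nrm (\<lambda>k. w k - ?w N k) * nrm (?v N) + C * nrm w * nrm (\<lambda>k. v k - ?v N k)"
      by (intro add_mono abil_bounded w v w' v')
    also have "nrm (?v N) \<le> nrm v"
      using proj_pythagoras[OF v, of "{..<N}"] dual_self_nonneg[OF v'(2)] by (simp add: nrm_dual)
    finally show ?thesis using C_pos nrm_nonneg[OF w'(2)] by (simp add: mult_left_mono)
  qed
  moreover have "(\<lambda>N. C * nrm (\<lambda>k. w k - ?w N k) * nrm v + C * nrm w * nrm (\<lambda>k. v k - ?v N k)) \<longlonglongrightarrow> 0"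
    by (auto intro!: tendsto_eq_intros truncation_tendsto w v)
  ultimately have "(\<lambda>N. abil A (?w N) (?v N) - abil A w v) \<longlonglongrightarrow> 0"
    by (rule Lim_null_comparison[OF always_eventually[OF allI]])
  then show ?thesis unfolding form by (rule LIM_zero_cancel)
qed

lemma abil_commute:
  assumes "seqV w" "seqV v" shows "abil A w v = abil A v w"
  using form_tendsto_abil[OF assms] form_tendsto_abil[OF assms(2,1)]
  by (simp add: form_commute[of _ w v] LIMSEQ_unique)

lemma abil_coercive:
  assumes "seqV v" shows "a * dual v v \<le> abil A v v"
proof (rule LIMSEQ_le[OF tendsto_mult_left[OF dual_partial_tendsto[OF assms assms]]
      form_tendsto_abil[OF assms assms]])
  show "\<exists>N. \<forall>n\<ge>N. a * (\<Sum>k<n. v k * v k) \<le> form n v v"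
    using form_lower[of v] assms by (auto simp: form_def seqV_def power2_eq_square)
qed

text \<open>The additive \<open>d\<close> accommodates the separate term in component 2, which does
  not depend on the section length.\<close>

lemma abil_upper:
  assumes "seqV v"
    and "\<And>N. (\<Sum>l<N. \<Sum>k<N. A l k * v k * v l) \<le> c * (\<Sum>k<N. (v k)\<^sup>2) + d"
  shows "abil A v v \<le> c * dual v v + d"
proof (rule LIMSEQ_le[OF form_tendsto_abil[OF assms(1) assms(1)]
      tendsto_add[OF tendsto_mult_left[OF dual_partial_tendsto[OF assms(1) assms(1)]] tendsto_const]])
  show "\<exists>N. \<forall>n\<ge>N. form n v v \<le> c * (\<Sum>k<n. v k * v k) + d"
    using assms(2) by (auto simp: form_def power2_eq_square)
qed

lemma abil_nonneg: "seqV v \<Longrightarrow> 0 \<le> abil A v v"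
  using abil_coercive[of v] a_pos dual_self_nonneg[of v] by (meson mult_nonneg_nonneg less_imp_le order_trans)

lemma abil_combination:
  assumes "seqV u" "seqV v"
  shows "abil A (\<lambda>k. c * u k + d * v k) (\<lambda>k. c * u k + d * v k)
    = c\<^sup>2 * abil A u u + 2 * c * d * abil A u v + d\<^sup>2 * abil A v v"
proof -
  let ?w = "\<lambda>k. c * u k + d * v k"
  have "abil A ?w ?w = c * abil A u ?w + d * abil A v ?w"
    by (intro abil_lincomb_left seqV_lincomb assms)
  also have "abil A u ?w = c * abil A u u + d * abil A u v"
    by (intro abil_lincomb_right assms)
  also have "abil A v ?w = c * abil A u v + d * abil A v v"
    using abil_lincomb_right[OF assms assms(2)] abil_commute[OF assms] by simp
  finally show ?thesis by (simp add: algebra_simps power2_eq_square)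
qed

lemma abil_cauchy_schwarz:
  assumes "seqV u" "seqV v" shows "(abil A u v)\<^sup>2 \<le> abil A u u * abil A v v"
proof (rule cauchy_schwarz_discriminant)
  show "0 \<le> abil A u u + 2 * t * abil A u v + t\<^sup>2 * abil A v v" for t
    using abil_combination[OF assms, of 1 t] abil_nonneg[OF seqV_lincomb[OF assms, of 1 t]] by simp
qed (use assms abil_nonneg in auto)

lemma mat_app_eq_unique:
  assumes "seqV x" "seqV y" "\<And>l. 2 \<le> l \<Longrightarrow> mat_app A x l = mat_app A y l"
  shows "x = y"
proof -
  let ?d = "\<lambda>k. 1 * x k + (-1) * y k"
  have d: "seqV ?d" by (intro seqV_lincomb assms)
  have "mat_app A ?d l = 0" for l
    using mat_app_lincomb[OF assms(1,2), of 1 "-1" l] assms(3)[of l]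
    by (cases "2 \<le> l") (auto simp: mat_app_def)
  then have "abil A ?d ?d = 0" by (simp add: abil_def)
  with abil_coercive[OF d] have "a * dual ?d ?d \<le> 0" by simp
  then have "dual ?d ?d \<le> 0" using a_pos by (simp add: mult_le_0_iff)
  then have "(?d k)\<^sup>2 \<le> 0" for k using component_le_dual[OF d, of k] by linarith
  then have "x k = y k" for k by simp
  then show ?thesis by blast
qed

section \<open>Solvability and the inverse matrix\<close>

text \<open>Richardson iteration: \<open>I - \<omega> A\<close> is a contraction for \<open>\<omega> = a / C\<^sup>2\<close>.\<close>
lemma mat_app_solvable:
  assumes b: "seqV b" obtains x where "seqV x" "mat_app A x = b"
proof -
  define \<omega> where "\<omega> = a / C\<^sup>2"
  define T where "T d = (\<lambda>k. 1 * d k + (- \<omega>) * mat_app A d k)" for d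
  \<comment> \<open>The \<open>max\<close> keeps the radicand nonnegative without comparing
    \<open>a\<close> and \<open>C\<close>.\<close>
  define q where "q = sqrt (max 0 (1 - a\<^sup>2 / C\<^sup>2))"
  have \<omega>: "0 < \<omega>" using a_pos C_pos by (simp add: \<omega>_def)
  have q: "0 \<le> q" "q < 1" using a_pos C_pos by (auto simp: q_def)
  have T: "seqV (T d)" "nrm (T d) \<le> q * nrm d" if d: "seqV d" for d
  proof -
    note Ad = mat_app_bounded[OF d]
    show "seqV (T d)" unfolding T_def by (intro seqV_lincomb d Ad)
    have "dual (T d) (T d) = dual d d + (- 2 * \<omega>) * abil A d d + \<omega>\<^sup>2 * dual (mat_app A d) (mat_app A d)"
      unfolding T_def dual_combination_self[OF d Ad(1)] by (simp add: abil_dual)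
    also have "dual (mat_app A d) (mat_app A d) \<le> C\<^sup>2 * dual d d"
      using power_mono[OF Ad(2) nrm_nonneg[OF Ad(1)], of 2] by (simp add: nrm_sq d Ad(1) power_mult_distrib)
    also have "(- 2 * \<omega>) * abil A d d \<le> (- 2 * \<omega>) * (a * dual d d)"
      using abil_coercive[OF d] \<omega> by (intro mult_left_mono_neg) auto
    finally have "dual (T d) (T d) \<le> dual d d + (- 2 * \<omega>) * (a * dual d d) + \<omega>\<^sup>2 * (C\<^sup>2 * dual d d)"
      using \<omega> by (simp add: mult_left_mono)
    also have "\<dots> = (1 - a\<^sup>2 / C\<^sup>2) * dual d d"
      using C_pos by (simp add: \<omega>_def power2_eq_square field_simps)
    also have "\<dots> \<le> max 0 (1 - a\<^sup>2 / C\<^sup>2) * dual d d"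
      using dual_self_nonneg[OF d] by (intro mult_right_mono) auto
    finally show "nrm (T d) \<le> q * nrm d"
      unfolding nrm_dual q_def real_sqrt_mult[symmetric] by (rule real_sqrt_le_mono)
  qed
  \<comment> \<open>Increments of the iteration; their partial sums \<open>S n\<close> are the
    iterates. By \<open>AS\<close> an increment is \<open>\<omega>\<close> times the residual of the
    iterate, so decay of the increments forces the limit to solve the system.\<close>
  define d where "d n = (T ^^ n) (\<lambda>k. \<omega> * b k)" for n
  have d: "seqV (d n)" "nrm (d n) \<le> q ^ n * nrm (d 0)" for n
  proof (induction n)
    case 0
    show "seqV (d 0)" "nrm (d 0) \<le> q ^ 0 * nrm (d 0)" by (simp_all add: d_def seqV_scale b)
  next
    case (Suc n)
    have "d (Suc n) = T (d n)" by (simp add: d_def)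
    with T[OF Suc(1)] q mult_left_mono[OF Suc(2), of q]
    show "seqV (d (Suc n))" "nrm (d (Suc n)) \<le> q ^ Suc n * nrm (d 0)" by auto
  qed
  define S where "S n = (\<lambda>k. \<Sum>i<n. d i k)" for n
  have S0: "S 0 = (\<lambda>_. 0)" and S_Suc: "S (Suc n) = (\<lambda>k. 1 * S n k + 1 * d n k)" for n
    by (simp_all add: S_def)
  have S: "seqV (S n)" for n
  proof (induction n)
    case (Suc n)
    then show ?case unfolding S_Suc by (intro seqV_lincomb d)
  qed (simp add: S0 seqV_zero)
  have AS: "d n k = \<omega> * b k - \<omega> * mat_app A (S n) k" for n k
  proof (induction n)
    case 0
    have "mat_app A (S 0) k = 0" using mat_app_lincomb[OF seqV_zero seqV_zero, of 0 0 k] by (simp add: S0)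
    then show ?case by (simp add: d_def)
  next
    case (Suc n)
    have "d (Suc n) k = d n k - \<omega> * mat_app A (d n) k" by (simp add: d_def T_def)
    then show ?case
      using Suc mat_app_lincomb[OF S d(1), of 1 n 1 n k] unfolding S_Suc by (simp add: algebra_simps)
  qed
  define \<epsilon> where "\<epsilon> n = q ^ n * (nrm (d 0) / (1 - q))" for n
  have cauchy: "nrm (\<lambda>k. S m k - S n k) \<le> \<epsilon> n" if "n \<le> m" for m n
  proof -
    \<comment> \<open>The exact geometric sum, rather than its bound \<open>\<epsilon> n\<close>,
      lets the induction on \<open>j\<close> close.\<close>
    have "nrm (\<lambda>k. S (n + j) k - S n k) \<le> (q ^ n - q ^ (n + j)) * (nrm (d 0) / (1 - q))" for j
    proof (induction j)
      case 0
      then show ?case by (simp add: nrm_def)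
    next
      case (Suc j)
      have "nrm (\<lambda>k. S (n + Suc j) k - S n k) = nrm (\<lambda>k. (S (n + j) k - S n k) + d (n + j) k)"
        by (simp add: S_def algebra_simps)
      also have "\<dots> \<le> nrm (\<lambda>k. S (n + j) k - S n k) + nrm (d (n + j))"
        by (intro nrm_triangle seqV_diff S d)
      also have "\<dots> \<le> (q ^ n - q ^ (n + j)) * (nrm (d 0) / (1 - q)) + q ^ (n + j) * nrm (d 0)"
        by (intro add_mono Suc d)
      also have "\<dots> = (q ^ n - q ^ (n + Suc j)) * (nrm (d 0) / (1 - q))"
        using q by (simp add: field_simps)
      finally show ?case .
    qed
    from this[of "m - n"] have "nrm (\<lambda>k. S m k - S n k) \<le> (q ^ n - q ^ m) * (nrm (d 0) / (1 - q))"
      using that by simp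
    also have "\<dots> \<le> \<epsilon> n"
      unfolding \<epsilon>_def using q nrm_nonneg[OF d(1)[of 0]] by (intro mult_right_mono) auto
    finally show ?thesis .
  qed
  have \<epsilon>0: "\<epsilon> \<longlonglongrightarrow> 0"
    unfolding \<epsilon>_def[abs_def] using q by (auto intro!: tendsto_eq_intros LIMSEQ_power_zero)
  obtain x where x: "seqV x" "\<And>n. nrm (\<lambda>k. x k - S n k) \<le> \<epsilon> n"
    using ell2_complete[of S \<epsilon>, OF S \<epsilon>0 cauchy] by blast
  have "mat_app A x k = b k" for k
  proof -
    have "norm (mat_app A x k - mat_app A (S n) k) \<le> C * \<epsilon> n" for n
    proof -
      let ?e = "\<lambda>k. 1 * x k + (-1) * S n k"
      have e: "seqV ?e" by (intro seqV_lincomb x S)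
      have "(mat_app A ?e k)\<^sup>2 \<le> (nrm (mat_app A ?e))\<^sup>2"
        using component_le_dual[OF mat_app_bounded(1)[OF e]] by (simp only: nrm_sq mat_app_bounded(1)[OF e])
      then have "\<bar>mat_app A ?e k\<bar> \<le> nrm (mat_app A ?e)"
        using nrm_nonneg[OF mat_app_bounded(1)[OF e]] by (metis abs_le_square_iff abs_of_nonneg)
      also have "\<dots> \<le> C * nrm ?e" by (rule mat_app_bounded(2)[OF e])
      also have "\<dots> \<le> C * \<epsilon> n" using x(2)[of n] C_pos by simp
      finally show ?thesis using mat_app_lincomb[OF x(1) S, of 1 "-1" n k] by simp
    qed
    then have "\<forall>n. norm (mat_app A x k - mat_app A (S n) k) \<le> C * \<epsilon> n" by blast
    moreover have "(\<lambda>n. C * \<epsilon> n) \<longlonglongrightarrow> 0" using tendsto_mult_left[OF \<epsilon>0, of C] by simp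
    ultimately have "(\<lambda>n. mat_app A x k - mat_app A (S n) k) \<longlonglongrightarrow> 0"
      by (rule Lim_null_comparison[OF always_eventually])
    moreover have "(\<lambda>n. mat_app A x k - mat_app A (S n) k) \<longlonglongrightarrow> mat_app A x k - b k"
    proof -
      have "(\<lambda>n. d n k) \<longlonglongrightarrow> 0"
      proof (rule Lim_null_comparison[OF always_eventually])
        show "\<forall>n. norm (d n k) \<le> q ^ n * nrm (d 0)"
        proof
          fix n
          have "(d n k)\<^sup>2 \<le> (nrm (d n))\<^sup>2" using component_le_dual[OF d(1)] by (simp add: nrm_sq d)
          then have "\<bar>d n k\<bar> \<le> nrm (d n)"
            using nrm_nonneg[OF d(1)] by (metis abs_le_square_iff abs_of_nonneg)
          with d(2)[of n] show "norm (d n k) \<le> q ^ n * nrm (d 0)" by simp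
        qed
        show "(\<lambda>n. q ^ n * nrm (d 0)) \<longlonglongrightarrow> 0"
          using q by (auto intro!: tendsto_eq_intros LIMSEQ_power_zero)
      qed
      then have "(\<lambda>n. mat_app A x k - (b k - d n k / \<omega>)) \<longlonglongrightarrow> mat_app A x k - (b k - 0 / \<omega>)"
        using \<omega> by (intro tendsto_intros) auto
      moreover have "b k - d n k / \<omega> = mat_app A (S n) k" for n
        using AS[of n k] \<omega> by (simp add: field_simps)
      ultimately show ?thesis by simp
    qed
    ultimately show ?thesis by (metis LIMSEQ_unique eq_iff_diff_eq_0)
  qed
  then show ?thesis using that x(1) by blast
qed

lemma inv_mat_column:
  assumes "2 \<le> k"
  shows "seqV (\<lambda>l. inv_mat A l k)" "mat_app A (\<lambda>l. inv_mat A l k) = unitv k"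
proof -
  obtain x where x: "seqV x" "mat_app A x = unitv k"
    using mat_app_solvable[OF seqV_unitv[OF assms]] .
  have "(\<lambda>l. inv_mat A l k) = x"
    unfolding inv_mat_def
    by (rule ext, rule arg_cong[where f = "\<lambda>g. g _"], rule the_equality)
      (use x mat_app_eq_unique in auto)
  with x show "seqV (\<lambda>l. inv_mat A l k)" "mat_app A (\<lambda>l. inv_mat A l k) = unitv k" by auto
qed

text \<open>Finite support reduces the product to a finite combination of columns, so no convergence
  question arises; the sets selected by \<open>dorfler\<close> are finite.\<close>

lemma mat_app_inv_mat:
  assumes g: "finite D" "D \<subseteq> {2..}" "\<And>k. k \<notin> D \<Longrightarrow> g k = 0"
  shows "seqV (mat_app (inv_mat A) g)" "mat_app A (mat_app (inv_mat A) g) = g"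
proof -
  have col0: "inv_mat A l k = 0" if "l < 2" "2 \<le> k" for l k
    using inv_mat_column(1)[OF that(2)] that(1) by (auto simp: seqV_def less_2_cases_iff)
  have "seqV (\<lambda>l. \<Sum>k\<in>D. inv_mat A l k * g k) \<and>
      mat_app A (\<lambda>l. \<Sum>k\<in>D. inv_mat A l k * g k) = (\<lambda>l. if l \<in> D then g l else 0)"
    using g(1,2)
  proof (induction D)
    case empty
    have "mat_app A (\<lambda>_. 0) l = 0" for l
      using mat_app_lincomb[OF seqV_zero seqV_zero, of 0 0 l] by simp
    then show ?case by (auto simp: seqV_zero)
  next
    case (insert j D)
    then have j: "2 \<le> j" by simp
    let ?y = "\<lambda>l. \<Sum>k\<in>D. inv_mat A l k * g k"
    have y: "seqV ?y" "mat_app A ?y = (\<lambda>l. if l \<in> D then g l else 0)" using insert by auto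
    have "(\<lambda>l. \<Sum>k\<in>insert j D. inv_mat A l k * g k) = (\<lambda>l. g j * inv_mat A l j + 1 * ?y l)"
      using insert by (simp add: mult.commute)
    moreover have "mat_app A (\<lambda>l. g j * inv_mat A l j + 1 * ?y l) l = (if l \<in> insert j D then g l else 0)" for l
      unfolding mat_app_lincomb[OF inv_mat_column(1)[OF j] y(1)] inv_mat_column(2)[OF j] y(2)
      using insert.hyps by (auto simp: unitv_def)
    moreover have "seqV (\<lambda>l. g j * inv_mat A l j + 1 * ?y l)"
      by (intro seqV_lincomb inv_mat_column(1) j y)
    ultimately show ?case by auto
  qed
  moreover have "mat_app (inv_mat A) g = (\<lambda>l. \<Sum>k\<in>D. inv_mat A l k * g k)"
  proof
    fix l
    have inj: "inj_on (\<lambda>k. k - 2) D" using g(2) by (intro inj_on_diff_nat) auto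
    have "(\<Sum>k. inv_mat A l (k + 2) * g (k + 2)) = (\<Sum>k\<in>(\<lambda>k. k - 2) ` D. inv_mat A l (k + 2) * g (k + 2))"
    proof (rule suminf_finite)
      show "inv_mat A l (n + 2) * g (n + 2) = 0" if "n \<notin> (\<lambda>k. k - 2) ` D" for n
        using that g(3)[of "n + 2"] by (metis add_diff_cancel_right' imageI mult_zero_right)
    qed (use g in auto)
    also have "\<dots> = (\<Sum>k\<in>D. inv_mat A l k * g k)"
      unfolding sum.reindex[OF inj] o_def
      using g(2) by (intro sum.cong refl) (auto simp: subset_iff simp del: add_2_eq_Suc')
    finally show "mat_app (inv_mat A) g l = (\<Sum>k\<in>D. inv_mat A l k * g k)"
      using g(2) col0 by (auto simp: mat_app_def subset_iff)
  qed
  moreover have "(\<lambda>l. if l \<in> D then g l else 0) = g" using g(3) by auto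
  ultimately show "seqV (mat_app (inv_mat A) g)" "mat_app A (mat_app (inv_mat A) g) = g" by auto
qed

end

section \<open>Galerkin solutions and corrections\<close>

lemma dual_unitv: "dual (unitv k) g = g k"
  unfolding dual_def unitv_def by (subst suminf_finite[of "{k}"]) auto

lemma dual_proj_self: "dual (proj S v) v = dual (proj S v) (proj S v)"
  unfolding dual_def proj_def by (intro suminf_cong) auto

context coercive_matrix begin

lemma abil_unitv: "abil A w (unitv k) = mat_app A w k"
  by (simp add: abil_dual dual_unitv)

lemma galerkin_orthogonal:
  assumes "seqV u" "mat_app A u = f" "galerkin A f S w" "seqV v" "\<And>k. k \<notin> S \<Longrightarrow> v k = 0"
  shows "abil A (\<lambda>k. u k - w k) v = 0"
proof -
  have w: "seqV w" "abil A w v = dual f v"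
    using assms(3-5) by (auto simp: galerkin_def)
  have "abil A (\<lambda>k. 1 * u k + (-1) * w k) v = 1 * abil A u v + (-1) * abil A w v"
    by (intro abil_lincomb_left assms w)
  then show ?thesis using w(2) assms(2) by (simp add: abil_dual dual_commute)
qed

lemma galerkin_pythagoras:
  assumes "seqV u" "mat_app A u = f" "galerkin A f S w" "seqV v" "\<And>k. k \<notin> S \<Longrightarrow> v k = 0"
  shows "abil A (\<lambda>k. u k - v k) (\<lambda>k. u k - v k) =
    abil A (\<lambda>k. u k - w k) (\<lambda>k. u k - w k) + abil A (\<lambda>k. w k - v k) (\<lambda>k. w k - v k)"
proof -
  have w: "seqV w" "\<And>k. k \<notin> S \<Longrightarrow> w k = 0" using assms(3) by (auto simp: galerkin_def)
  have "abil A (\<lambda>k. u k - w k) (\<lambda>k. w k - v k) = 0"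
    by (rule galerkin_orthogonal[OF assms(1-3)]) (use assms w in \<open>auto intro: seqV_diff\<close>)
  then show ?thesis
    using abil_combination[of "\<lambda>k. u k - w k" "\<lambda>k. w k - v k" 1 1] assms w by (simp add: seqV_diff)
qed

lemma galerkin_quasi_optimal:
  assumes "seqV u" "mat_app A u = f" "galerkin A f S w" "seqV v" "\<And>k. k \<notin> S \<Longrightarrow> v k = 0"
  shows "abil A (\<lambda>k. u k - w k) (\<lambda>k. u k - w k) \<le> abil A (\<lambda>k. u k - v k) (\<lambda>k. u k - v k)"
proof -
  have "0 \<le> abil A (\<lambda>k. w k - v k) (\<lambda>k. w k - v k)"
    by (intro abil_nonneg seqV_diff assms) (use assms(3) in \<open>auto simp: galerkin_def\<close>)
  then show ?thesis using galerkin_pythagoras[OF assms] by simp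
qed

text \<open>Cauchy-Schwarz applied to the pairing of \<open>x\<close> with its image, then
  coercivity; one factor of the energy cancels.\<close>

lemma abil_inverse_bound:
  assumes "seqV x" shows "a * abil A x x \<le> dual (mat_app A x) (mat_app A x)"
proof -
  let ?g = "mat_app A x"
  have g: "seqV ?g" using assms by (rule mat_app_bounded)
  let ?Q = "abil A x x"
  have "?Q\<^sup>2 \<le> dual x x * dual ?g ?g"
    using dual_cauchy_schwarz_sq[OF assms g] by (simp add: abil_dual)
  then have "a * ?Q\<^sup>2 \<le> (a * dual x x) * dual ?g ?g" using a_pos by (simp add: mult_left_mono)
  also have "\<dots> \<le> ?Q * dual ?g ?g"
    by (intro mult_right_mono abil_coercive dual_self_nonneg assms g)
  finally have "(a * ?Q) * ?Q \<le> dual ?g ?g * ?Q" by (simp add: power2_eq_square algebra_simps)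
  then show ?thesis
    using abil_nonneg[OF assms] dual_self_nonneg[OF g] by (cases "?Q = 0") (auto simp: mult_le_cancel_right)
qed

text \<open>The upper bound is required at the residual alone, not at every sequence. A residual
  with vanishing component 2 can therefore be treated with 9/8 in place of 1.41.\<close>

lemma residual_bound:
  assumes "seqV e" "abil A (mat_app A e) (mat_app A e) \<le> c * dual (mat_app A e) (mat_app A e)"
  shows "dual (mat_app A e) (mat_app A e) \<le> c * abil A e e"
proof -
  let ?r = "mat_app A e" and ?R = "dual (mat_app A e) (mat_app A e)"
  have r: "seqV ?r" using assms(1) by (rule mat_app_bounded)
  have "?R\<^sup>2 \<le> abil A e e * abil A ?r ?r"
    using abil_cauchy_schwarz[OF assms(1) r] by (simp add: abil_dual)
  also have "\<dots> \<le> abil A e e * (c * ?R)"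
    by (intro mult_left_mono assms abil_nonneg)
  finally have le: "?R * ?R \<le> (c * abil A e e) * ?R" by (simp add: power2_eq_square algebra_simps)
  show ?thesis
  proof (cases "?R = 0")
    case True
    then have "\<And>k. (?r k)\<^sup>2 \<le> 0" using component_le_dual[OF r] by metis
    then have "abil A e e = 0" by (simp add: abil_def)
    then show ?thesis using True by simp
  next
    case False
    then show ?thesis using le dual_self_nonneg[OF r] by (simp add: mult_le_cancel_right)
  qed
qed

end

section \<open>Energy bounds with index 2 split off\<close>

text \<open>The basis function \<open>\<eta>\<^sub>2\<close> carries almost all of the \<open>L\<^sup>2\<close> norm; off the index 2 the
  continuity constant is only slightly larger than \<open>M = max \<nu>\<^sup>* \<sigma>\<^sup>*\<close>.\<close>
locale stiffness_form = coercive_matrix A a "141 / 100 * M"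
  for A :: "nat \<Rightarrow> nat \<Rightarrow> real" and a M :: real +
  assumes a_le_M: "a \<le> M"
    and form_upper_split: "\<And>v N. \<lbrakk>v 0 = 0; v 1 = 0\<rbrakk> \<Longrightarrow>
      (\<Sum>l<N. \<Sum>k<N. A l k * v k * v l) \<le> M * (9/8 * (\<Sum>k<N. (v k)\<^sup>2) + 61/200 * (v 2)\<^sup>2)"
begin

lemma M_pos: "0 < M"
  using C_pos by simp

lemma abil_le: "seqV v \<Longrightarrow> abil A v v \<le> 141 / 100 * M * dual v v"
  using abil_upper[of v "141 / 100 * M" 0] form_upper[of v] by (simp add: seqV_def)

lemma abil_le_split: "seqV v \<Longrightarrow> abil A v v \<le> M * (9/8 * dual v v + 61/200 * (v 2)\<^sup>2)"
  using abil_upper[of v "9/8 * M" "M * (61/200 * (v 2)\<^sup>2)"] form_upper_split[of v]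
  by (simp add: seqV_def algebra_simps)

text \<open>The witness is the banded inverse applied to the selected residual \<open>g\<close>;
  bandwidth \<open>J\<close> puts its support into the enriched set. Its error splits into the
  inverse applied to the unselected residual, small by bulk chasing, and \<open>z\<close>, the
  cut-off part of the inverse applied to \<open>g\<close>.\<close>

lemma enriched_approximation:
  assumes e: "seqV e" and D: "dorfler \<theta> (mat_app A e) D" and \<theta>: "0 < \<theta>" "\<theta> < 1"
    and J: "opnorm_le (\<lambda>l k. inv_mat A l k - band (inv_mat A) J l k) c"
    and c: "c \<le> sqrt ((1 - \<theta>\<^sup>2) / (a * M))"
  obtains w where "seqV w" "\<And>k. k \<notin> enrich D J \<Longrightarrow> w k = 0"
    "a * abil A (\<lambda>k. e k - w k) (\<lambda>k. e k - w k)
      \<le> 479 / 100 * (1 - \<theta>\<^sup>2) * dual (mat_app A e) (mat_app A e)"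
proof -
  define r where "r = mat_app A e"
  define g where "g = proj D r"
  let ?R = "dual r r" and ?s = "1 - \<theta>\<^sup>2"
  have s: "0 < ?s" using \<theta> by (simp add: power_less_one_iff)
  have r: "seqV r" unfolding r_def by (rule mat_app_bounded[OF e])
  have g: "seqV g" unfolding g_def by (rule seqV_proj[OF r])
  have D': "finite D" "D \<subseteq> {2..}" "\<And>k. k \<notin> D \<Longrightarrow> g k = 0"
    using D by (auto simp: dorfler_def g_def proj_def)
  have R: "?R = dual g g + dual (\<lambda>k. r k - g k) (\<lambda>k. r k - g k)"
    unfolding g_def by (rule proj_pythagoras[OF r])
  have "\<theta> * nrm r \<le> nrm g" using D by (simp add: dorfler_def r_def g_def)
  then have "(\<theta> * nrm r)\<^sup>2 \<le> (nrm g)\<^sup>2" using \<theta> nrm_nonneg[OF r] by (intro power_mono) auto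
  then have tail: "dual (\<lambda>k. r k - g k) (\<lambda>k. r k - g k) \<le> ?s * ?R"
    using R by (simp add: power_mult_distrib nrm_sq r g algebra_simps)
  define w0 where "w0 = mat_app (inv_mat A) g"
  define z where "z = mat_app (\<lambda>l k. inv_mat A l k - band (inv_mat A) J l k) g"
  \<comment> \<open>The banded inverse applied to \<open>g\<close>, written as a difference so that
    square summability follows from \<open>opnorm_le\<close>.\<close>
  define w where "w = (\<lambda>k. w0 k - z k)"
  have w0: "seqV w0" "mat_app A w0 = g" using mat_app_inv_mat[OF D'] by (auto simp: w0_def)
  have z: "seqV z" "nrm z \<le> c * nrm g" using J g by (auto simp: opnorm_le_def z_def)
  have w: "seqV w" unfolding w_def by (intro seqV_diff w0 z)
  have supp: "w k = 0" if k: "k \<notin> enrich D J" for k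
  proof (cases "k < 2")
    case False
    have "band (inv_mat A) J k (j + 2) * g (j + 2) = 0" for j
    proof (cases "j + 2 \<in> D")
      case True
      then show ?thesis using k False by (auto simp: band_def enrich_def)
    qed (simp add: D'(3))
    then have "(inv_mat A k (j + 2) - band (inv_mat A) J k (j + 2)) * g (j + 2)
        = inv_mat A k (j + 2) * g (j + 2)" for j
      by (simp only: left_diff_distrib diff_zero)
    then have "z k = w0 k" unfolding z_def w0_def mat_app_def by (simp only:)
    then show ?thesis by (simp add: w_def)
  qed (use w in \<open>auto simp: seqV_def less_2_cases_iff\<close>)
  let ?x = "\<lambda>k. 1 * e k + (-1) * w0 k"
  have x: "seqV ?x" by (intro seqV_lincomb e w0)
  have "mat_app A ?x k = r k - g k" for k
    using mat_app_lincomb[OF e w0(1), of 1 "-1" k] by (simp add: w0(2) r_def)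
  then have "mat_app A ?x = (\<lambda>k. r k - g k)" by blast
  then have Qx: "a * abil A ?x ?x \<le> ?s * ?R" using abil_inverse_bound[OF x] tail by simp
  have Qz: "a * abil A z z \<le> 141 / 100 * (?s * ?R)"
  proof -
    have "nrm z \<le> sqrt (?s / (a * M)) * nrm g"
      using z(2) c nrm_nonneg[OF g] mult_right_mono order_trans by blast
    then have "(nrm z)\<^sup>2 \<le> (sqrt (?s / (a * M)) * nrm g)\<^sup>2" using nrm_nonneg[OF z(1)] by (intro power_mono)
    then have "dual z z \<le> ?s / (a * M) * dual g g"
      using s a_pos M_pos by (simp add: power_mult_distrib nrm_sq z(1) g)
    also have "\<dots> \<le> ?s / (a * M) * ?R"
      using s a_pos M_pos R dual_self_nonneg[OF seqV_diff[OF r g]] by (intro mult_left_mono) auto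
    finally have "a * (141 / 100 * M * dual z z) \<le> a * (141 / 100 * M * (?s / (a * M) * ?R))"
      using a_pos M_pos by (intro mult_left_mono) auto
    also have "\<dots> = 141 / 100 * (?s * ?R)" using a_pos M_pos by simp
    finally show ?thesis using mult_left_mono[OF abil_le[OF z(1)], of a] a_pos by linarith
  qed
  \<comment> \<open>Young's inequality with the optimal weight \<open>\<surd>1.41 \<approx> 1.19\<close>\<close>
  let ?y = "\<lambda>k. 1 * ?x k + 1 * z k"
  have "0 \<le> abil A (\<lambda>k. (119/100) * ?x k + (-1) * z k) (\<lambda>k. (119/100) * ?x k + (-1) * z k)"
    by (intro abil_nonneg seqV_lincomb x z)
  then have "2 * abil A ?x z \<le> 119/100 * abil A ?x ?x + 100/119 * abil A z z"
    unfolding abil_combination[OF x z(1)] by (simp add: power2_eq_square)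
  then have "abil A ?y ?y \<le> 219/100 * abil A ?x ?x + 219/119 * abil A z z"
    unfolding abil_combination[OF x z(1)] by simp
  then have "a * abil A ?y ?y \<le> a * (219/100 * abil A ?x ?x + 219/119 * abil A z z)"
    using a_pos by (intro mult_left_mono) auto
  also have "\<dots> = 219/100 * (a * abil A ?x ?x) + 219/119 * (a * abil A z z)"
    by (simp add: algebra_simps)
  also have "\<dots> \<le> 219/100 * (?s * ?R) + 219/119 * (141 / 100 * (?s * ?R))"
    by (intro add_mono mult_left_mono Qx Qz) simp_all
  \<comment> \<open>The square of 1 + sqrt 1.41, about 4.785, rounded up.\<close>
  also have "\<dots> \<le> 479 / 100 * (?s * ?R)"
  proof -
    have "219/100 * x + 219/119 * (141 / 100 * x) \<le> 479 / 100 * x" if "0 \<le> x" for x :: real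
      using that by simp
    then show ?thesis using s dual_self_nonneg[OF r] by simp
  qed
  finally have "a * abil A (\<lambda>k. e k - w k) (\<lambda>k. e k - w k) \<le> 479 / 100 * ?s * ?R"
    by (simp add: w_def algebra_simps)
  with that[OF w] supp show ?thesis by (simp add: r_def)
qed

text \<open>Completing the square: \<open>c\<close> maximises twice the pairing with
  \<open>r\<close> minus the energy, so every trial \<open>v\<close> gives a lower bound for the
  energy of \<open>c\<close>, with the energy of \<open>v - c\<close> as defect.\<close>

lemma correction_identity:
  assumes "seqV c" "seqV v" "abil A c v = dual v r"
  shows "abil A c c = 2 * dual v r - abil A v v + abil A (\<lambda>k. v k - c k) (\<lambda>k. v k - c k)"
  using abil_combination[OF assms(2,1), of 1 "-1"] assms(3) abil_commute[OF assms(1,2)] by simp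

lemma correction_lower:
  assumes r: "seqV r" and c: "seqV c"
    and orth: "\<And>v. \<lbrakk>seqV v; \<And>k. k \<notin> S \<Longrightarrow> v k = 0\<rbrakk> \<Longrightarrow> abil A c v = dual v r"
  shows "dual (proj S r) (proj S r) \<le> 141/100 * M * abil A c c"
proof -
  let ?P = "dual (proj S r) (proj S r)"
  \<comment> \<open>Maximiser of 2 \<beta> P - 1.41 M \<beta>^2 P.\<close>
  define \<beta> where "\<beta> = 100 / (141 * M)"
  define v where "v = (\<lambda>k. \<beta> * proj S r k)"
  have P: "seqV (proj S r)" by (rule seqV_proj[OF r])
  have v: "seqV v" unfolding v_def by (rule seqV_scale[OF P])
  have "abil A c v = dual v r" by (rule orth[OF v]) (simp add: v_def proj_def)
  note id = correction_identity[OF c v this]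
  have vr: "dual v r = \<beta> * ?P" unfolding v_def by (simp add: dual_scale P r dual_proj_self)
  have "dual v v = \<beta>\<^sup>2 * ?P"
    using dual_combination_self[OF P P, of \<beta> 0] by (simp add: v_def)
  then have "abil A v v \<le> 141/100 * M * (\<beta>\<^sup>2 * ?P)" using abil_le[OF v] by simp
  also have "\<dots> = \<beta> * ?P" using M_pos by (simp add: \<beta>_def power2_eq_square)
  finally have "\<beta> * ?P \<le> abil A c c"
    using id vr abil_nonneg[OF seqV_diff[OF v c]] by simp
  then have "141/100 * M * (\<beta> * ?P) \<le> 141/100 * M * abil A c c" using M_pos by simp
  then show ?thesis using M_pos by (simp add: \<beta>_def)
qed

text \<open>Testing with a multiple of the residual whose component 2 is tuned to the given value
  \<open>c 2\<close>: since \<open>r 2\<close> is eliminated by optimisation, only \<open>c 2\<close> remains in the bound.\<close>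
lemma correction_lower_split:
  assumes r: "seqV r" and c: "seqV c"
    and orth: "\<And>v. \<lbrakk>seqV v; \<And>k. k \<notin> S \<Longrightarrow> v k = 0\<rbrakk> \<Longrightarrow> abil A c v = dual v r"
    and S: "2 \<in> S" and a: "3/5 * M \<le> a"
  shows "8/9 * dual (proj S r) (proj S r) \<le> M * abil A c c + 63/100 * M\<^sup>2 * (c 2)\<^sup>2"
proof -
  let ?P = "dual (proj S r) (proj S r)"
  \<comment> \<open>The optimal step for the continuity constant 9/8 \<open>M\<close> valid off
    index 2.\<close>
  define \<beta> where "\<beta> = 8 / (9 * M)"
  define X where "X = \<beta> * r 2"
  \<comment> \<open>Minimiser over \<open>V\<close> of the quadratic 9/8 (V - X)^2 + 61/200 V^2 -
    3/5 (V - c 2)^2, whose leading coefficient is 83/100.\<close>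
  define V where "V = (9/8 * X - 3/5 * c 2) * (100 / 83)"
  define \<gamma> where "\<gamma> = V - X"
  define v where "v = (\<lambda>k. \<beta> * proj S r k + \<gamma> * unitv 2 k)"
  have P: "seqV (proj S r)" by (rule seqV_proj[OF r])
  have e2: "seqV (unitv 2)" by (rule seqV_unitv) simp
  have v: "seqV v" unfolding v_def by (intro seqV_lincomb P e2)
  have v2: "v 2 = V" using S by (simp add: v_def proj_def unitv_def \<gamma>_def X_def)
  have "abil A c v = dual v r" by (rule orth[OF v]) (use S in \<open>auto simp: v_def proj_def unitv_def\<close>)
  note id = correction_identity[OF c v this]
  have vr: "dual v r = \<beta> * ?P + \<gamma> * r 2"
    unfolding v_def dual_lincomb[OF P e2 r] by (simp add: dual_proj_self dual_unitv)
  have "dual (proj S r) (unitv 2) = r 2"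
    using S by (subst dual_commute) (simp add: dual_unitv proj_def)
  then have vv: "dual v v = \<beta>\<^sup>2 * ?P + 2 * \<beta> * \<gamma> * r 2 + \<gamma>\<^sup>2"
    unfolding v_def dual_combination_self[OF P e2] by (simp add: dual_unitv) (simp add: unitv_def)
  \<comment> \<open>The defect is not dropped: coercivity keeps its component 2, and this ties the
    bound to \<open>c 2\<close>.\<close>
  have "3/5 * M * (V - c 2)\<^sup>2 \<le> a * dual (\<lambda>k. v k - c k) (\<lambda>k. v k - c k)"
    using component_le_dual[OF seqV_diff[OF v c], of 2] a a_pos M_pos by (intro mult_mono) (auto simp: v2)
  also have "\<dots> \<le> abil A (\<lambda>k. v k - c k) (\<lambda>k. v k - c k)" by (intro abil_coercive seqV_diff v c)
  finally have gap: "3/5 * M * (V - c 2)\<^sup>2 \<le> abil A (\<lambda>k. v k - c k) (\<lambda>k. v k - c k)" .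
  have "2 * (\<beta> * ?P + \<gamma> * r 2) - M * (9/8 * (\<beta>\<^sup>2 * ?P + 2 * \<beta> * \<gamma> * r 2 + \<gamma>\<^sup>2) + 61/200 * V\<^sup>2)
      + 3/5 * M * (V - c 2)\<^sup>2 \<le> abil A c c"
    using id vr vv v2 gap abil_le_split[OF v] by simp
  then have "M * (2 * (\<beta> * ?P + \<gamma> * r 2) - M * (9/8 * (\<beta>\<^sup>2 * ?P + 2 * \<beta> * \<gamma> * r 2 + \<gamma>\<^sup>2) + 61/200 * V\<^sup>2)
      + 3/5 * M * (V - c 2)\<^sup>2) \<le> M * abil A c c" using M_pos by (intro mult_left_mono) auto
  moreover have "M * (2 * (\<beta> * ?P + \<gamma> * r 2) - M * (9/8 * (\<beta>\<^sup>2 * ?P + 2 * \<beta> * \<gamma> * r 2 + \<gamma>\<^sup>2) + 61/200 * V\<^sup>2)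
      + 3/5 * M * (V - c 2)\<^sup>2)
    = 8/9 * ?P - M\<^sup>2 * (9/8 * (V - X)\<^sup>2 + 61/200 * V\<^sup>2 - 3/5 * (V - c 2)\<^sup>2)"
  proof -
    have "M * \<beta> = 8/9" using M_pos by (simp add: \<beta>_def)
    then show ?thesis unfolding \<gamma>_def by algebra
  qed
  moreover have "9/8 * (V - X)\<^sup>2 + 61/200 * V\<^sup>2 - 3/5 * (V - c 2)\<^sup>2 \<le> 63/100 * (c 2)\<^sup>2"
  proof -
    \<comment> \<open>With \<open>V\<close> inserted the claim is a definite quadratic form in
      \<open>X\<close> and \<open>c 2\<close>; this is its completed square up to a positive factor.
      The constant 63/100 leaves a small slack.\<close>
    have "0 \<le> 59 * (X - 120/59 * c 2)\<^sup>2 + 18924/13275 * (c 2)\<^sup>2"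
      by (intro add_nonneg_nonneg mult_nonneg_nonneg) simp_all
    then show ?thesis unfolding V_def by (simp add: power2_eq_square algebra_simps)
  qed
  then have "M\<^sup>2 * (9/8 * (V - X)\<^sup>2 + 61/200 * V\<^sup>2 - 3/5 * (V - c 2)\<^sup>2) \<le> M\<^sup>2 * (63/100 * (c 2)\<^sup>2)"
    by (intro mult_left_mono) auto
  ultimately show ?thesis by simp
qed

end

section \<open>Contraction of one adaptive step\<close>

text \<open>The critical case in scaled quantities: \<open>T\<close> is the squared contraction
  factor, \<open>t\<close> is a/M, \<open>\<rho>\<close> the squared residual norm over
  \<open>M\<close>, and \<open>P\<close> its part on the enlarged index set over \<open>M\<close>.
  \<open>E\<close>, \<open>Q\<close> and \<open>Qc\<close> are the energies of the intermediate
  Galerkin error, the discarded part and the correction; \<open>N\<close> and \<open>y\<close> are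
  \<open>M\<close> times the squared norm of the discarded part and its squared component 2. The
  term \<open>T * t\<^sup>2 / 36\<close> is 1 - \<theta>^2.\<close>

lemma contraction_arithmetic:
  fixes T t \<rho> E Q N y P Qc :: real
  assumes T: "0 \<le> T" "T \<le> 1" and t: "0 \<le> t" "t \<le> 1" and \<rho>: "0 \<le> \<rho>"
    and E: "E \<le> 1331/10000 * t * T * \<rho>"
    and N: "N \<le> 4/9 * T * \<rho>" and y: "y \<le> N"
    and Q: "Q \<le> 141/100 * N" "Q \<le> 9/8 * N + 61/200 * y"
    and P: "(1 - T * t\<^sup>2 / 36) * \<rho> \<le> P"
    and c: "P \<le> 141/100 * Qc" "3/5 \<le> t \<Longrightarrow> 8/9 * P \<le> Qc + 63/100 * y"
  shows "E + Q \<le> T * (Qc + E)"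
proof -
  have t2: "t\<^sup>2 \<le> 1" using t by (simp add: power_le_one)
  have tE: "(1 - T) * E \<le> (1 - T) * (1331/10000 * t * T * \<rho>)"
    using E T by (intro mult_left_mono) auto
  \<comment> \<open>The goal amounts to (1 - T) E + Q being at most T Qc. With every term bounded by
    a multiple of T \<rho>, it becomes a comparison of coefficients.\<close>
  have scale: "E + Q \<le> T * (Qc + E)" if "q * T * \<rho> \<ge> Q" "g * \<rho> \<le> Qc"
    "1331/10000 * ((1 - T) * t) + q \<le> g" for q g
  proof -
    have "(1331/10000 * ((1 - T) * t) + q) * (T * \<rho>) \<le> g * (T * \<rho>)"
      using that(3) T \<rho> by (intro mult_right_mono) auto
    moreover have "(1331/10000 * ((1 - T) * t) + q) * (T * \<rho>)
        = (1 - T) * (1331/10000 * t * T * \<rho>) + q * T * \<rho>" by algebra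
    moreover have "g * (T * \<rho>) \<le> T * Qc"
      using mult_left_mono[OF that(2) T(1)] by (simp add: mult_ac)
    moreover have "T * (Qc + E) = T * Qc + (E - (1 - T) * E)" by algebra
    ultimately show ?thesis using tE that(1) by linarith
  qed
  define p where "p = (1 - T) * t"
  define m where "m = T * t\<^sup>2"
  have pT: "p \<le> 1 - T" using mult_left_mono[OF t(2), of "1 - T"] T by (simp add: p_def)
  have mT: "m \<le> T" using mult_left_mono[OF t2 T(1)] by (simp add: m_def)
  have uniform: "E + Q \<le> T * (Qc + E)" if "1331/10000 * p + 94/150 \<le> 100/141 - 100/5076 * m"
  proof (rule scale)
    show "Q \<le> 94/150 * T * \<rho>" using Q(1) N by simp
    show "(100/141 - 100/5076 * m) * \<rho> \<le> Qc" using P c(1) by (simp add: m_def algebra_simps)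
    show "1331/10000 * ((1 - T) * t) + 94/150 \<le> 100/141 - 100/5076 * m"
      using that by (simp only: p_def)
  qed
  \<comment> \<open>For \<open>T\<close> near 0 the uniform constants work only up to
    \<open>t\<close> about 0.62. For \<open>T\<close> at least 1/2 the factor 1 - T already shrinks
    the share of \<open>E\<close>; what remains needs the split bound.\<close>
  consider "t < 3/5" | "3/5 \<le> t" "1/2 \<le> T" | "3/5 \<le> t" "T \<le> 1/2" by linarith
  then show ?thesis
  proof cases
    case 1
    have "t\<^sup>2 \<le> (3/5)\<^sup>2" using 1 t by (intro power_mono) auto
    from mult_left_mono[OF this T(1)] have "m \<le> 9/25 * T" by (simp add: m_def power2_eq_square)
    moreover have "p \<le> 3/5 * (1 - T)"
      using mult_left_mono[of t "3/5" "1 - T"] 1 T by (simp add: p_def)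
    ultimately show ?thesis using T by (intro uniform) (simp add: field_simps)
  next
    case 2
    then show ?thesis using pT mT T by (intro uniform) (simp add: field_simps)
  next
    case 3
    show ?thesis
    proof (rule scale)
      \<comment> \<open>The loss in \<open>y\<close> is at most a multiple of T \<rho>, so for
        \<open>T\<close> up to 1/2 it costs less than is gained by 8/9 over 100/141.\<close>
      show "Q \<le> 143/225 * T * \<rho>" using Q(2) N y by simp
      show "(8/9 - 2/81 * m - 7/25 * T) * \<rho> \<le> Qc"
        using P c(2)[OF 3(1)] N y by (simp add: m_def algebra_simps)
      have "1331/10000 * p + 143/225 \<le> 8/9 - 2/81 * m - 7/25 * T"
        using pT mT 3(2) T by (simp add: field_simps)
      then show "1331/10000 * ((1 - T) * t) + 143/225 \<le> 8/9 - 2/81 * m - 7/25 * T"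
        by (simp only: p_def)
    qed
  qed
qed

context stiffness_form begin

text \<open>The constant \<open>M\<close> is not a continuity constant of the form: only \<open>1.41 M\<close> is. The
  loss is harmless unless both the residual \<open>r\<close> and the discarded part \<open>d\<close> are concentrated at
  the index 2. As \<open>r\<close> vanishes on \<open>S\<close>, this forces \<open>2 \<notin> S\<close>; then \<open>d 2 = c 2\<close> for the
  correction \<open>c = uh - w\<close>, and the energy of \<open>c\<close> compensates.\<close>
lemma adaptive_step_contraction:
  assumes u: "seqV u" "mat_app A u = f" and \<theta>: "0 < \<theta>" "\<theta> < 1"
    and \<rho>: "6 * (M / a) * sqrt (1 - \<theta>\<^sup>2) < 1"
    and w: "galerkin A f S w"
    and r: "r = mat_app A (\<lambda>k. u k - w k)"
    and D: "dorfler \<theta> r D"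
    and J: "opnorm_le (\<lambda>l k. inv_mat A l k - band (inv_mat A) J l k) c\<^sub>J"
      "c\<^sub>J \<le> sqrt ((1 - \<theta>\<^sup>2) / (a * M))"
    and Sh: "Sh = S \<union> enrich D J"
    and uh: "galerkin A f Sh uh"
    and S': "coarse uh (2 / a * sqrt (1 - \<theta>\<^sup>2) * nrm r) Sh S'"
    and w': "galerkin A f S' w'"
  shows "abil A (\<lambda>k. u k - w' k) (\<lambda>k. u k - w' k)
    \<le> (6 * (M / a) * sqrt (1 - \<theta>\<^sup>2))\<^sup>2 * abil A (\<lambda>k. u k - w k) (\<lambda>k. u k - w k)"
proof -
  define e where "e = (\<lambda>k. u k - w k)"
  define c where "c = (\<lambda>k. uh k - w k)"
  define d where "d = (\<lambda>k. uh k - proj S' uh k)"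
  define T where "T = (6 * (M / a) * sqrt (1 - \<theta>\<^sup>2))\<^sup>2"
  define t where "t = a / M"
  let ?Q = "\<lambda>v. abil A v v" and ?E = "abil A (\<lambda>k. u k - uh k) (\<lambda>k. u k - uh k)"
  let ?s = "1 - \<theta>\<^sup>2" and ?R = "dual r r"
  have w_V: "seqV w" "\<And>k. k \<notin> S \<Longrightarrow> w k = 0" and uh_V: "seqV uh" "\<And>k. k \<notin> Sh \<Longrightarrow> uh k = 0"
    using w uh by (auto simp: galerkin_def)
  have V: "seqV e" "seqV c" "seqV d"
    unfolding e_def c_def d_def by (intro seqV_diff seqV_proj u w_V uh_V)+
  have r_V: "seqV r" and r_e: "r = mat_app A e"
    using mat_app_bounded(1)[OF V(1)] by (simp_all add: r e_def)
  have s: "0 < ?s" using \<theta> by (simp add: power_less_one_iff)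
  have t: "0 < t" "t \<le> 1" using a_pos M_pos a_le_M by (simp_all add: t_def)
  have T_eq: "T = 36 * ?s / t\<^sup>2"
    using s by (simp add: T_def t_def power_mult_distrib power_divide)
  have "0 \<le> 6 * (M / a) * sqrt ?s" using M_pos a_pos s by simp
  then have T: "0 \<le> T" "T \<le> 1" using \<rho> by (auto simp: T_def power_le_one)
  have s_T: "?s = T * t\<^sup>2 / 36" using t by (simp add: T_eq)
  have R: "0 \<le> ?R" by (rule dual_self_nonneg[OF r_V])

  obtain v where v: "seqV v" "\<And>k. k \<notin> enrich D J \<Longrightarrow> v k = 0"
    "a * ?Q (\<lambda>k. e k - v k) \<le> 479 / 100 * ?s * ?R"
    using enriched_approximation[OF V(1) _ \<theta> J(1,2)] D unfolding r_e by blast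
  have "?E \<le> ?Q (\<lambda>k. u k - (w k + v k))"
    by (rule galerkin_quasi_optimal[OF u uh])
      (use v w_V Sh in \<open>auto intro: seqV_add\<close>)
  then have "a * ?E \<le> a * ?Q (\<lambda>k. e k - v k)" using a_pos by (simp add: e_def diff_diff_eq)
  also have "\<dots> \<le> 479 / 100 * ?s * ?R" by (rule v)
  also have "\<dots> = 479/3600 * (a * (t * T * (?R / M)))"
    using a_pos M_pos unfolding s_T by (simp add: t_def power2_eq_square)
  also have "\<dots> \<le> 1331/10000 * (a * (t * T * (?R / M)))"
    by (rule mult_right_mono) (use t T a_pos M_pos R in simp_all)
  finally have "a * ?E \<le> a * (1331/10000 * t * T * (?R / M))" by (simp only: mult_ac)
  then have E: "?E \<le> 1331/10000 * t * T * (?R / M)" using a_pos by (simp only: mult_le_cancel_left_pos)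

  have "nrm d \<le> 2 * (2 / a * sqrt ?s * nrm r)" using S' by (simp add: coarse_def d_def)
  then have "(nrm d)\<^sup>2 \<le> (4 / a * sqrt ?s * nrm r)\<^sup>2"
    using nrm_nonneg[OF V(3)] by (intro power_mono) auto
  then have "dual d d \<le> 16 / a\<^sup>2 * ?s * ?R"
    using s by (simp add: power_mult_distrib power_divide nrm_sq V r_V)
  \<comment> \<open>Twice the coarsening tolerance is 4/a sqrt(1 - \<theta>^2) times the residual
    norm: 16 of the 36 parts of \<open>T\<close>.\<close>
  also have "\<dots> = 4/9 * T * ?R / M\<^sup>2"
    using a_pos unfolding s_T by (simp add: t_def power_divide)
  finally have "M * dual d d \<le> M * (4/9 * T * ?R / M\<^sup>2)"
    using M_pos by (intro mult_left_mono) auto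
  then have N: "M * dual d d \<le> 4/9 * T * (?R / M)" using M_pos by (simp add: power2_eq_square)
  have Qd: "?Q d \<le> 141/100 * (M * dual d d)" "?Q d \<le> 9/8 * (M * dual d d) + 61/200 * (M * (d 2)\<^sup>2)"
    using abil_le[OF V(3)] abil_le_split[OF V(3)] by (simp_all add: algebra_simps)

  have S'_Sh: "S' \<subseteq> Sh" using S' by (simp add: coarse_def)
  have "abil A (\<lambda>k. u k - w' k) (\<lambda>k. u k - w' k) \<le> ?Q (\<lambda>k. u k - proj S' uh k)"
    by (rule galerkin_quasi_optimal[OF u w' seqV_proj[OF uh_V(1)]]) (simp add: proj_def)
  also have "\<dots> = ?E + ?Q d"
    unfolding d_def by (rule galerkin_pythagoras[OF u uh seqV_proj[OF uh_V(1)]])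
      (use S'_Sh in \<open>auto simp: proj_def\<close>)
  also have "\<dots> \<le> T * ?Q e"
  proof -
    have c_Sh: "w k = 0" if "k \<notin> Sh" for k using that w_V(2) Sh by auto
    have Qe: "?Q e = ?Q c + ?E"
      using galerkin_pythagoras[OF u uh w_V(1) c_Sh] by (simp add: e_def c_def)
    have crude: "?R / M \<le> 141/100 * ?Q e"
      using residual_bound[OF V(1), of "141/100 * M"] abil_le[OF r_V] M_pos
      by (simp add: r_e[symmetric] field_simps)
    have tTR: "1331/10000 * t * T * (?R / M) \<le> 1331/10000 * (T * (?R / M))"
    proof -
      have "t * (T * (?R / M)) \<le> 1 * (T * (?R / M))"
        using t T R M_pos by (intro mult_right_mono) auto
      then have "1331/10000 * (t * (T * (?R / M))) \<le> 1331/10000 * (T * (?R / M))"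
        unfolding mult_1_left by (rule mult_left_mono) simp
      then show ?thesis by (simp only: mult.assoc)
    qed
    \<comment> \<open>One improved constant is enough: with 9/8 for the residual the total is 9/8
      (0.1331 + 0.6267), with 9/8 for \<open>d\<close> it is 1.41 (0.1331 + 0.5), both below 1. In
      the last case the energy of \<open>c\<close> must be retained.\<close>
    consider "2 \<in> S" | "d 2 = 0" | "2 \<notin> S" "d 2 \<noteq> 0" by blast
    then show ?thesis
    proof cases
      case 1
      have "abil A e (unitv 2) = 0"
        unfolding e_def
      proof (rule galerkin_orthogonal[OF u w seqV_unitv])
        show "unitv 2 k = 0" if "k \<notin> S" for k using 1 that by (auto simp: unitv_def)
      qed simp
      then have "r 2 = 0" by (simp add: abil_unitv r_e)
      then have "?Q r \<le> (9/8 * M) * ?R" using abil_le_split[OF r_V] by simp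
      then have "?R \<le> 9/8 * M * ?Q e"
        using residual_bound[OF V(1), of "9/8 * M"] by (simp add: r_e[symmetric])
      then have "?R / M \<le> 9/8 * ?Q e" using M_pos by (simp add: field_simps)
      then have "T * (?R / M) \<le> T * (9/8 * ?Q e)" using T by (intro mult_left_mono)
      moreover have "0 \<le> T * ?Q e" using T abil_nonneg[OF V(1)] by simp
      ultimately show ?thesis using E N Qd(1) tTR by simp
    next
      case 2
      have "T * (?R / M) \<le> T * (141/100 * ?Q e)" using T crude by (intro mult_left_mono)
      moreover have "0 \<le> T * ?Q e" using T abil_nonneg[OF V(1)] by simp
      ultimately show ?thesis using E N Qd(2) tTR 2 by simp
    next
      case 3
      have "2 \<notin> S'" "uh 2 \<noteq> 0" "d 2 = uh 2" using 3 by (auto simp: d_def proj_def split: if_splits)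
      then have "2 \<in> Sh" "d 2 = c 2" using uh_V w_V 3 by (auto simp: c_def)
      have orth: "abil A c x = dual x r" if x: "seqV x" "\<And>k. k \<notin> Sh \<Longrightarrow> x k = 0" for x
      proof -
        have "abil A (\<lambda>k. u k - uh k) x = 0" by (rule galerkin_orthogonal[OF u uh x])
        moreover have "abil A (\<lambda>k. 1 * e k + (-1) * (u k - uh k)) x
            = 1 * abil A e x + (-1) * abil A (\<lambda>k. u k - uh k) x"
          by (intro abil_lincomb_left V x seqV_diff u uh_V)
        moreover have "(\<lambda>k. 1 * e k + (-1) * (u k - uh k)) = c" by (auto simp: e_def c_def)
        ultimately have "abil A c x = abil A e x" by simp
        then show ?thesis by (simp only: abil_dual r_e)
      qed
      let ?P = "dual (proj Sh r) (proj Sh r)"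
      have "(1 - ?s) * ?R \<le> ?P"
      proof -
        have "D \<subseteq> Sh"
        proof
          fix k assume "k \<in> D"
          moreover from this have "2 \<le> k" using D by (auto simp only: dorfler_def)
          ultimately have "k \<in> enrich D J" unfolding enrich_def by (blast intro: le_add1)
          then show "k \<in> Sh" by (simp only: Sh Un_iff simp_thms)
        qed
        have "\<theta> * nrm r \<le> nrm (proj D r)" using D by (simp add: dorfler_def)
        then have "(\<theta> * nrm r)\<^sup>2 \<le> (nrm (proj D r))\<^sup>2"
          using \<theta> nrm_nonneg[OF r_V] by (intro power_mono) auto
        then have "\<theta>\<^sup>2 * ?R \<le> dual (proj D r) (proj D r)"
          by (simp add: power_mult_distrib nrm_sq r_V seqV_proj)
        also have "proj D r = proj D (proj Sh r)" using \<open>D \<subseteq> Sh\<close> by (auto simp: proj_def fun_eq_iff)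
        also have "dual (proj D (proj Sh r)) (proj D (proj Sh r)) \<le> ?P"
          using proj_pythagoras[OF seqV_proj[OF r_V, of Sh], of D]
            dual_self_nonneg[OF seqV_diff[OF seqV_proj[OF r_V, of Sh] seqV_proj[OF seqV_proj[OF r_V, of Sh], of D]]]
          by simp
        finally show ?thesis by simp
      qed
      then have P: "(1 - T * t\<^sup>2 / 36) * (?R / M) \<le> ?P / M"
        unfolding s_T using M_pos by (simp add: divide_right_mono)
      have "?P / M \<le> 141/100 * ?Q c"
        using correction_lower[OF r_V V(2) orth] M_pos by (simp add: field_simps)
      moreover have "8/9 * (?P / M) \<le> ?Q c + 63/100 * (M * (d 2)\<^sup>2)" if "3/5 \<le> t"
      proof -
        have "3/5 * M \<le> a" using that M_pos by (simp add: t_def field_simps)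
        from correction_lower_split[OF r_V V(2) orth \<open>2 \<in> Sh\<close> this]
        have "8/9 * ?P \<le> M * (?Q c + 63/100 * (M * (d 2)\<^sup>2))"
          using \<open>d 2 = c 2\<close> by (simp add: algebra_simps power2_eq_square)
        then show ?thesis using M_pos by (simp add: field_simps)
      qed
      moreover have "M * (d 2)\<^sup>2 \<le> M * dual d d" using component_le_dual[OF V(3)] M_pos by simp
      ultimately have "?E + ?Q d \<le> T * (?Q c + ?E)"
        using t R M_pos by (intro contraction_arithmetic[OF T _ _ _ E N _ Qd P]) auto
      then show ?thesis by (simp add: Qe)
    qed
  qed
  finally show ?thesis by (simp add: T_def e_def)
qed

end

section \<open>From the differential operator to the algorithm\<close>

lemma smooth_on_continuous:
  assumes "smooth_on S g" shows "continuous_on S g"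
proof -
  have "g differentiable (at x)" if "x \<in> S" for x
    using assms that unfolding smooth_on_def by (metis funpow_0)
  then show ?thesis
    by (meson continuous_at_imp_continuous_on differentiable_imp_continuous_within)
qed

lemma stiffness_form_stiff:
  assumes nu: "smooth_on {-1<..<1} nu" "\<forall>x\<in>{-1<..<1}. nulo \<le> nu x \<and> nu x \<le> nuhi"
    and sg: "smooth_on {-1<..<1} sg" "\<forall>x\<in>{-1<..<1}. 0 \<le> sg x \<and> sg x \<le> sghi"
    and nulo: "0 < nulo"
  shows "stiffness_form (stiff nu sg) nulo (max nuhi sghi)"
proof -
  have b: "nulo \<le> nu x \<and> nu x \<le> nuhi" "0 \<le> sg x \<and> sg x \<le> sghi" if "x \<in> {-1<..<1}" for x
    using nu sg that by auto
  note lower = stiff_form_lower[OF smooth_on_continuous[OF nu(1)] b(1) smooth_on_continuous[OF sg(1)] b(2) nulo]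
  note upper = stiff_form_upper[OF smooth_on_continuous[OF nu(1)] b(1) smooth_on_continuous[OF sg(1)] b(2) nulo]
  have "nulo \<le> max nuhi sghi" using b(1)[of 0] by auto
  show ?thesis
  proof (unfold_locales)
    fix v :: "nat \<Rightarrow> real" and N
    assume v: "v 0 = 0" "v 1 = 0"
    show "nulo * (\<Sum>k<N. (v k)\<^sup>2) \<le> (\<Sum>l<N. \<Sum>k<N. stiff nu sg l k * v k * v l)"
      by (rule lower[OF _ _ v]) auto
    show "(\<Sum>l<N. \<Sum>k<N. stiff nu sg l k * v k * v l)
        \<le> max nuhi sghi * (9/8 * (\<Sum>k<N. (v k)\<^sup>2) + 61/200 * (v 2)\<^sup>2)"
      \<comment> \<open>Here \<open>q\<close> is fixed at 1/8, the value forced by index 3 up to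
        rounding; \<tau> = 9/4 nearly exhausts the condition at index 4, and 61/200 absorbs the
        remainder at index 2.\<close>
      using upper[OF _ _ v, of "9/4" "61/200" "1/8" N] by simp
    show "(\<Sum>l<N. \<Sum>k<N. stiff nu sg l k * v k * v l)
        \<le> 141 / 100 * max nuhi sghi * (\<Sum>k<N. (v k)\<^sup>2)"
      \<comment> \<open>With \<tau> = 20/3 the coupling adds exactly 1/100 to the diagonal mass 2/5
        at index 2.\<close>
      using upper[OF _ _ v, of "20/3" 0 "41/100" N] by (simp add: mult_ac)
  qed (use nulo \<open>nulo \<le> max nuhi sghi\<close> stiff_sym in auto)
qed

text \<open>The sequences describe the unstopped run, so termination reads as: some index meets the
  stopping test. The procedures are relations, which covers every choice among minimal sets.
  \<open>nrm\<close> is the L2 norm of the derivative, equivalent to the H1 norm on functions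
  vanishing at the end points.\<close>

theorem mainTheorem9:
  fixes nu sg :: "real \<Rightarrow> real"
    and nulo nuhi sghi theta etaL cL etabar CAinv :: real
    and f u :: "nat \<Rightarrow> real"
    and Lam Lamh D :: "nat \<Rightarrow> nat set"
    and uh un r :: "nat \<Rightarrow> nat \<Rightarrow> real"
  defines "A \<equiv> stiff nu sg"
    and "rho \<equiv> 6 * ((max nuhi sghi) / nulo) * sqrt (1 - theta\<^sup>2)"
    and "Jtheta \<equiv> (LEAST J::nat. CAinv * exp (- etabar * real J) \<le> sqrt ((1 - theta\<^sup>2) / (nulo * (max nuhi sghi))))"
  assumes nu_smooth: "smooth_on {-1<..<1} nu"
    and sg_smooth: "smooth_on {-1<..<1} sg"
    and nulo_pos: "0 < nulo"
    and nu_bounds: "\<forall>x\<in>{-1<..<1}. nulo \<le> nu x \<and> nu x \<le> nuhi"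
    and sg_bounds: "\<forall>x\<in>{-1<..<1}. 0 \<le> sg x \<and> sg x \<le> sghi"
    and f_dual: "seqV f"
    and u_V: "seqV u"
    and u_sol: "\<forall>v. seqV v \<longrightarrow> abil A u v = dual f v"
    and theta_pos: "0 < theta" and theta_lt: "theta < 1"
    and rho_lt: "rho < 1"
    and A_decay: "\<forall>m\<ge>2. \<forall>n\<ge>2. \<bar>A m n\<bar> \<le> cL * exp (- etaL * \<bar>real m - real n\<bar>)"
    and cL_small: "cL < 1/2 * (exp etaL - 1) * (INF l\<in>{2..}. A l l)"
    and etabar_pos: "0 < etabar"
    and etabar_root: "(exp (- etabar))\<^sup>2
        - (exp (2 * etaL) + 2 * cL + 1) / (exp etaL * (cL + 1)) * exp (- etabar) + 1 = 0"
    and CAinv_bound: "\<forall>J::nat. opnorm_le (\<lambda>l k. inv_mat A l k - band (inv_mat A) J l k)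
                                        (CAinv * exp (- etabar * real J))"
    and init_Lam: "Lam 0 = {}"
    and init_u: "un 0 = (\<lambda>_. 0)"
    and init_r: "r 0 = f"
    and step_dorfler: "\<forall>n. dorfler theta (r n) (D n)"
    and step_enrich: "\<forall>n. Lamh (Suc n) = Lam n \<union> enrich (D n) Jtheta"
    and step_gal1: "\<forall>n. galerkin A f (Lamh (Suc n)) (uh (Suc n))"
    and step_coarse: "\<forall>n. coarse (uh (Suc n)) (2 / nulo * sqrt (1 - theta\<^sup>2) * nrm (r n))
                                (Lamh (Suc n)) (Lam (Suc n))"
    and step_gal2: "\<forall>n. galerkin A f (Lam (Suc n)) (un (Suc n))"
    and step_res: "\<forall>n. r (Suc n) = res A f (un (Suc n))"
  shows "(\<forall>n. enorm A (\<lambda>k. u k - un (Suc n) k) \<le> rho * enorm A (\<lambda>k. u k - un n k))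
       \<and> (\<forall>tol>0. \<exists>n. nrm (r (Suc n)) \<le> tol)
       \<and> ((\<lambda>n. nrm (\<lambda>k. u k - un n k)) \<longlonglongrightarrow> 0)"
proof -
  let ?M = "max nuhi sghi"
  interpret stiffness_form A nulo ?M
    unfolding A_def by (rule stiffness_form_stiff[OF nu_smooth nu_bounds sg_smooth sg_bounds nulo_pos])
  define err where "err n = enorm A (\<lambda>k. u k - un n k)" for n
  have f_eq: "mat_app A u = f"
  proof
    fix k
    show "mat_app A u k = f k"
    proof (cases "k < 2")
      case False
      then have "abil A u (unitv k) = dual f (unitv k)" using u_sol seqV_unitv by simp
      then show ?thesis by (simp add: abil_unitv dual_commute[of f] dual_unitv)
    qed (use f_dual in \<open>auto simp: seqV_def mat_app_def less_2_cases_iff\<close>)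
  qed
  \<comment> \<open>The zero start is the Galerkin solution on the empty set, so the initial step
    needs no special treatment.\<close>
  have gal: "galerkin A f (Lam n) (un n)" for n
  proof (cases n)
    case 0
    have "abil A (\<lambda>_. 0) v = dual f v" if "\<forall>k. k \<notin> {} \<longrightarrow> v k = 0" for v :: "nat \<Rightarrow> real"
    proof -
      have "v = (\<lambda>_. 0)" using that by auto
      then show ?thesis by (simp add: abil_def dual_def)
    qed
    then show ?thesis unfolding 0 init_Lam init_u by (simp add: galerkin_def seqV_zero)
  qed (use step_gal2 in simp)
  then have un: "seqV (un n)" for n by (simp add: galerkin_def)
  have e: "seqV (\<lambda>k. u k - un n k)" for n by (intro seqV_diff u_V un)
  have r: "r n = mat_app A (\<lambda>k. u k - un n k)" for n
  proof (cases n)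
    case 0
    then show ?thesis using init_r init_u f_eq by simp
  next
    case (Suc m)
    show ?thesis
    proof
      fix k
      have "mat_app A (\<lambda>k. 1 * u k + (-1) * un n k) k = f k - mat_app A (un n) k"
        using mat_app_lincomb[OF u_V un, of 1 "-1" n k] f_eq by simp
      then show "r n k = mat_app A (\<lambda>k. u k - un n k) k"
        using step_res Suc by (auto simp: res_def abil_unitv mat_app_def)
    qed
  qed
  have theta2: "theta\<^sup>2 < 1" using theta_pos theta_lt by (simp add: power_less_one_iff)
  have rho_nonneg: "0 \<le> rho" using M_pos nulo_pos theta2 by (simp add: rho_def)
  \<comment> \<open>The defining property of \<open>Jtheta\<close> holds once some \<open>J\<close>
    satisfies it: the left side tends to 0 and the right side is positive.\<close>
  have J: "CAinv * exp (- etabar * real Jtheta) \<le> sqrt ((1 - theta\<^sup>2) / (nulo * ?M))"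
    unfolding Jtheta_def
  proof (rule LeastI_ex)
    have "(\<lambda>J. CAinv * exp (- etabar) ^ J) \<longlonglongrightarrow> CAinv * 0"
      using etabar_pos by (intro tendsto_intros LIMSEQ_power_zero) auto
    moreover have "exp (- etabar) ^ J = exp (- etabar * real J)" for J
      by (simp add: exp_of_nat_mult[symmetric] mult.commute)
    ultimately have "(\<lambda>J. CAinv * exp (- etabar * real J)) \<longlonglongrightarrow> 0" by simp
    moreover have "0 < sqrt ((1 - theta\<^sup>2) / (nulo * ?M))" using theta2 nulo_pos M_pos by simp
    ultimately have "eventually (\<lambda>J. CAinv * exp (- etabar * real J) < sqrt ((1 - theta\<^sup>2) / (nulo * ?M))) sequentially"
      by (rule order_tendstoD)
    then show "\<exists>J. CAinv * exp (- etabar * real J) \<le> sqrt ((1 - theta\<^sup>2) / (nulo * ?M))"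
      by (meson eventually_happens' less_imp_le sequentially_bot)
  qed
  have step: "err (Suc n) \<le> rho * err n" for n
  proof -
    have "abil A (\<lambda>k. u k - un (Suc n) k) (\<lambda>k. u k - un (Suc n) k)
        \<le> rho\<^sup>2 * abil A (\<lambda>k. u k - un n k) (\<lambda>k. u k - un n k)"
      unfolding rho_def
    proof (rule adaptive_step_contraction[OF u_V f_eq theta_pos theta_lt _ gal r _ _ J])
      show "6 * (?M / nulo) * sqrt (1 - theta\<^sup>2) < 1" using rho_lt by (simp add: rho_def)
      show "dorfler theta (r n) (D n)" using step_dorfler by simp
      show "Lamh (Suc n) = Lam n \<union> enrich (D n) Jtheta" using step_enrich by simp
      show "galerkin A f (Lamh (Suc n)) (uh (Suc n))" using step_gal1 by simp
      show "coarse (uh (Suc n)) (2 / nulo * sqrt (1 - theta\<^sup>2) * nrm (r n)) (Lamh (Suc n)) (Lam (Suc n))"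
        using step_coarse by simp
      show "galerkin A f (Lam (Suc n)) (un (Suc n))" by (rule gal)
      show "opnorm_le (\<lambda>l k. inv_mat A l k - band (inv_mat A) Jtheta l k) (CAinv * exp (- etabar * real Jtheta))"
        using CAinv_bound by simp
    qed
    then have "err (Suc n) \<le> sqrt (rho\<^sup>2 * abil A (\<lambda>k. u k - un n k) (\<lambda>k. u k - un n k))"
      unfolding err_def enorm_def by (rule real_sqrt_le_mono)
    then show ?thesis using rho_nonneg by (simp add: err_def enorm_def real_sqrt_mult)
  qed
  have "err n \<le> rho ^ n * err 0" for n
  proof (induction n)
    case (Suc n)
    then show ?case using step[of n] mult_left_mono[OF Suc rho_nonneg] by simp
  qed simp
  moreover have "nrm (\<lambda>k. u k - un n k) \<le> err n / sqrt nulo" for n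
  proof -
    have "sqrt (nulo * dual (\<lambda>k. u k - un n k) (\<lambda>k. u k - un n k)) \<le> err n"
      unfolding err_def enorm_def by (rule real_sqrt_le_mono[OF abil_coercive[OF e]])
    then show ?thesis using nulo_pos by (simp add: nrm_dual real_sqrt_mult field_simps)
  qed
  ultimately have "nrm (\<lambda>k. u k - un n k) \<le> rho ^ n * err 0 / sqrt nulo" for n
    using nulo_pos by (meson divide_right_mono order_trans real_sqrt_ge_zero less_imp_le)
  then have bound: "\<forall>n. norm (nrm (\<lambda>k. u k - un n k)) \<le> rho ^ n * err 0 / sqrt nulo"
    using nrm_nonneg[OF e] by simp
  have "(\<lambda>n. rho ^ n * err 0 / sqrt nulo) \<longlonglongrightarrow> 0"
    using rho_nonneg rho_lt nulo_pos by (auto intro!: tendsto_eq_intros LIMSEQ_power_zero)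
  then have conv: "(\<lambda>n. nrm (\<lambda>k. u k - un n k)) \<longlonglongrightarrow> 0"
    by (rule Lim_null_comparison[OF always_eventually[OF bound]])
  have "\<exists>n. nrm (r (Suc n)) \<le> tol" if tol: "0 < tol" for tol
  proof -
    let ?C = "141 / 100 * ?M"
    have "(\<lambda>n. ?C * nrm (\<lambda>k. u k - un (Suc n) k)) \<longlonglongrightarrow> 0"
      using tendsto_mult_left[OF LIMSEQ_Suc[OF conv], of ?C] by simp
    then have "eventually (\<lambda>n. ?C * nrm (\<lambda>k. u k - un (Suc n) k) < tol) sequentially"
      using tol by (rule order_tendstoD)
    then obtain n where "?C * nrm (\<lambda>k. u k - un (Suc n) k) < tol"
      by (meson eventually_happens' sequentially_bot)
    then have "nrm (r (Suc n)) \<le> tol" using mat_app_bounded(2)[OF e, of "Suc n"] by (simp add: r)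
    then show ?thesis ..
  qed
  then show ?thesis using step conv by (simp add: err_def)
qed

end
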